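(* Assume there exists a completely separable MAD family of subsets of $\omega$. Then the modal logic $\mathsf{S4.1.2}$ is the logic of the space $\beta\omega$: for every set of modal formulas $\Gamma$ and every modal formula $\varphi$, $\Gamma\vdash_{\mathsf{S4.1.2}}\varphi$ if and only if $\Gamma\models_{\beta\omega}\varphi$.
   Context: $\mathsf{S4}$ is axiomatized by classical propositional logic plus the schemata $\Box(\varphi\to\psi)\to(\Box\varphi\to\Box\psi)$, $\Box\varphi\to\varphi$, $\Box\varphi\to\Box\Box\varphi$, with modus ponens and necessitation $\varphi/\Box\varphi$; $\Diamond\varphi=\neg\Box\neg\varphi$; $\Gamma\vdash_{\mathsf{L}}\varphi$ means $\varphi$ is derivable from $\Gamma$ (with necessitation applicable to all derived formulas). $\mathsf{S4.1.2}$ is $\mathsf{S4}$ plus the axiom $\Box\Diamond\varphi\leftrightarrow\Diamond\Box\varphi$. A topological model on a space $X$ is a valuation where Boolean connectives are pointwise and $x\Vdash\Box\varphi$ iff some open $U\ni x$ has $y\Vdash\varphi$ for all $y\in U$ (so $\Box$ is interior, $\Diamond$ is closure). $\Gamma\models_X\varphi$ means every topological model on $X$ validating all formulas of $\Gamma$ at every point validates $\varphi$ at every point. $\beta\omega$ is the Čech–Stone compactification of discrete $\omega$. An AD family is $\mathcal A\subseteq[\omega]^\omega$ with pairwise finite intersections; MAD means infinite and inclusion-maximal; $\mathcal A$ is completely separable if every $X\subseteq\omega$ not in the ideal generated by $\mathcal A$ and finite sets is either almost disjoint from all members of $\mathcal A$ or satisfies $A\setminus X$ finite for some $A\in\mathcal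 A$. *)

theory Defs
  imports "HOL-Analysis.Analysis"
begin

section \<open>Modal formulas\<close>

datatype fm =
    Var nat
  | Fls ("\<^bold>\<bottom>")
  | Imp fm fm (infixr "\<^bold>\<longrightarrow>" 55)
  | Box fm ("\<box> _" [70] 70)

abbreviation Neg :: "fm \<Rightarrow> fm" ("\<^bold>\<not> _" [70] 70)
  where "\<^bold>\<not> \<phi> \<equiv> \<phi> \<^bold>\<longrightarrow> \<^bold>\<bottom>"

abbreviation And :: "fm \<Rightarrow> fm \<Rightarrow> fm" (infixr "\<^bold>\<and>" 65)
  where "\<phi> \<^bold>\<and> \<psi> \<equiv> \<^bold>\<not> (\<phi> \<^bold>\<longrightarrow> \<^bold>\<not> \<psi>)"

abbreviation Iff :: "fm \<Rightarrow> fm \<Rightarrow> fm" (infixr "\<^bold>\<longleftrightarrow>" 55)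
  where "\<phi> \<^bold>\<longleftrightarrow> \<psi> \<equiv> (\<phi> \<^bold>\<longrightarrow> \<psi>) \<^bold>\<and> (\<psi> \<^bold>\<longrightarrow> \<phi>)"

abbreviation Dia :: "fm \<Rightarrow> fm" ("\<diamond> _" [70] 70)
  where "\<diamond> \<phi> \<equiv> \<^bold>\<not> \<box> \<^bold>\<not> \<phi>"

section \<open>The global consequence relation of S4.1.2\<close>

text \<open>Boolean evaluation treating variables and boxed formulas as atoms; the tautologies are
  exactly the substitution instances of classical propositional tautologies.\<close>

primrec bool_eval :: "(nat \<Rightarrow> bool) \<Rightarrow> (fm \<Rightarrow> bool) \<Rightarrow> fm \<Rightarrow> bool" where
  "bool_eval g h (Var p) \<longleftrightarrow> g p"
| "bool_eval g h \<^bold>\<bottom> \<longleftrightarrow> False"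
| "bool_eval g h (\<phi> \<^bold>\<longrightarrow> \<psi>) \<longleftrightarrow> (bool_eval g h \<phi> \<longrightarrow> bool_eval g h \<psi>)"
| "bool_eval g h (\<box> \<phi>) \<longleftrightarrow> h \<phi>"

definition tautology :: "fm \<Rightarrow> bool" where
  "tautology \<phi> \<longleftrightarrow> (\<forall>g h. bool_eval g h \<phi>)"

definition S4_axioms :: "fm set" where
  "S4_axioms = {\<phi>. tautology \<phi>}
     \<union> {\<box> (\<phi> \<^bold>\<longrightarrow> \<psi>) \<^bold>\<longrightarrow> (\<box> \<phi> \<^bold>\<longrightarrow> \<box> \<psi>) |\<phi> \<psi>. True}
     \<union> {\<box> \<phi> \<^bold>\<longrightarrow> \<phi> |\<phi>. True}
     \<union> {\<box> \<phi> \<^bold>\<longrightarrow> \<box> \<box> \<phi> |\<phi>. True}"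

definition S412_axioms :: "fm set" where
  "S412_axioms = S4_axioms \<union> {\<box> \<diamond> \<phi> \<^bold>\<longleftrightarrow> \<diamond> \<box> \<phi> |\<phi>. True}"

text \<open>Necessitation applies to every derived formula, including those depending on \<open>\<Gamma>\<close>.\<close>

inductive derivable :: "fm set \<Rightarrow> fm set \<Rightarrow> fm \<Rightarrow> bool" for Ax \<Gamma> :: "fm set" where
  axiom: "\<phi> \<in> Ax \<Longrightarrow> derivable Ax \<Gamma> \<phi>"
| premise: "\<phi> \<in> \<Gamma> \<Longrightarrow> derivable Ax \<Gamma> \<phi>"
| mp: "derivable Ax \<Gamma> (\<phi> \<^bold>\<longrightarrow> \<psi>) \<Longrightarrow> derivable Ax \<Gamma> \<phi> \<Longrightarrow> derivable Ax \<Gamma> \<psi>"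
| nec: "derivable Ax \<Gamma> \<phi> \<Longrightarrow> derivable Ax \<Gamma> (\<box> \<phi>)"

abbreviation S412_derivable :: "fm set \<Rightarrow> fm \<Rightarrow> bool" ("_ \<turnstile>\<^sub>S\<^sub>4\<^sub>1\<^sub>2 _" [50, 50] 50)
  where "\<Gamma> \<turnstile>\<^sub>S\<^sub>4\<^sub>1\<^sub>2 \<phi> \<equiv> derivable S412_axioms \<Gamma> \<phi>"

section \<open>Topological semantics\<close>

primrec forces :: "'x topology \<Rightarrow> (nat \<Rightarrow> 'x \<Rightarrow> bool) \<Rightarrow> 'x \<Rightarrow> fm \<Rightarrow> bool" where
  "forces X V x (Var p) \<longleftrightarrow> V p x"
| "forces X V x \<^bold>\<bottom> \<longleftrightarrow> False"
| "forces X V x (\<phi> \<^bold>\<longrightarrow> \<psi>) \<longleftrightarrow> (forces X V x \<phi> \<longrightarrow> forces X V x \<psi>)"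
| "forces X V x (\<box> \<phi>) \<longleftrightarrow> (\<exists>U. openin X U \<and> x \<in> U \<and> (\<forall>y\<in>U. forces X V y \<phi>))"

definition valid_in :: "'x topology \<Rightarrow> (nat \<Rightarrow> 'x \<Rightarrow> bool) \<Rightarrow> fm \<Rightarrow> bool" where
  "valid_in X V \<phi> \<longleftrightarrow> (\<forall>x\<in>topspace X. forces X V x \<phi>)"

definition consequence :: "fm set \<Rightarrow> 'x topology \<Rightarrow> fm \<Rightarrow> bool" ("_ \<Turnstile>[_] _" [50, 0, 50] 50) where
  "\<Gamma> \<Turnstile>[X] \<phi> \<longleftrightarrow> (\<forall>V. (\<forall>\<gamma>\<in>\<Gamma>. valid_in X V \<gamma>) \<longrightarrow> valid_in X V \<phi>)"

section \<open>Almost disjoint families\<close>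

definition AD_family :: "nat set set \<Rightarrow> bool" where
  "AD_family \<A> \<longleftrightarrow> (\<forall>A\<in>\<A>. infinite A) \<and> (\<forall>A\<in>\<A>. \<forall>B\<in>\<A>. A \<noteq> B \<longrightarrow> finite (A \<inter> B))"

definition MAD_family :: "nat set set \<Rightarrow> bool" where
  "MAD_family \<A> \<longleftrightarrow> AD_family \<A> \<and> infinite \<A> \<and> (\<forall>\<B>. AD_family \<B> \<longrightarrow> \<A> \<subseteq> \<B> \<longrightarrow> \<B> = \<A>)"

inductive_set ideal_generated :: "nat set set \<Rightarrow> nat set set" for \<A> :: "nat set set" where
  finite: "finite X \<Longrightarrow> X \<in> ideal_generated \<A>"
| member: "A \<in> \<A> \<Longrightarrow> A \<in> ideal_generated \<A>"
| union: "X \<in> ideal_generated \<A> \<Longrightarrow> Y \<in> ideal_generated \<A> \<Longrightarrow> X \<union> Y \<in> ideal_generated \<A>"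
| subset: "X \<in> ideal_generated \<A> \<Longrightarrow> Y \<subseteq> X \<Longrightarrow> Y \<in> ideal_generated \<A>"

definition completely_separable :: "nat set set \<Rightarrow> bool" where
  "completely_separable \<A> \<longleftrightarrow>
     (\<forall>X. X \<notin> ideal_generated \<A> \<longrightarrow> (\<forall>A\<in>\<A>. finite (X \<inter> A)) \<or> (\<exists>A\<in>\<A>. finite (A - X)))"

section \<open>The space \<open>\<beta>\<omega>\<close>\<close>

definition ultrafilter :: "'a filter \<Rightarrow> bool" where
  "ultrafilter U \<longleftrightarrow> U \<noteq> bot \<and> (\<forall>P. eventually P U \<or> eventually (\<lambda>x. \<not> P x) U)"

definition stone_set :: "nat set \<Rightarrow> nat filter set" where
  "stone_set A = {U. ultrafilter U \<and> (\<forall>\<^sub>F n in U. n \<in> A)}"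

definition \<beta>\<omega> :: "nat filter topology" where
  "\<beta>\<omega> = topology_generated_by (range stone_set)"

text \<open>The theorems \<open>compact_beta\<close>, \<open>Hausdorff_beta\<close>, \<open>embedding_beta\<close>, \<open>dense_beta\<close> and
  \<open>extension_beta\<close> below say that \<open>\<beta>\<omega>\<close>, with \<open>n\<close> embedded as the principal ultrafilter at \<open>n\<close>,
  is the Cech--Stone compactification of the discrete space \<open>\<omega>\<close>.\<close>

lemma ultrafilter_principal: "ultrafilter (principal {n})"
  by (auto simp: ultrafilter_def eventually_principal principal_eq_bot_iff)

lemma ultrafilter_not: "ultrafilter U \<Longrightarrow> eventually (\<lambda>x. \<not> P x) U \<longleftrightarrow> \<not> eventually P U"
  using eventually_elim2[of P U "\<lambda>x. \<not> P x" "\<lambda>_. False"]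
  by (auto simp: ultrafilter_def trivial_limit_def)

lemma ultrafilter_exists:
  assumes "F \<noteq> (bot :: 'a filter)"
  obtains U where "ultrafilter U" "U \<le> F"
proof -
  let ?S = "{G. G \<noteq> bot \<and> G \<le> F}"
  let ?r = "{(a, b). a \<in> ?S \<and> b \<in> ?S \<and> b \<le> a}"
  have FR: "Field ?r = ?S" by (auto simp: Field_def)
  have "\<exists>m\<in>Field ?r. \<forall>a\<in>Field ?r. (m, a) \<in> ?r \<longrightarrow> a = m"
  proof (rule Zorns_po_lemma)
    show "Partial_order ?r"
      unfolding partial_order_on_def preorder_on_def FR
      by (auto simp: refl_on_def trans_def antisym_def)
  next
    fix C assume C: "C \<in> Chains ?r"
    then have CS: "C \<subseteq> ?S" and lin: "\<And>a b. a \<in> C \<Longrightarrow> b \<in> C \<Longrightarrow> a \<le> b \<or> b \<le> a"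
      by (auto simp: Chains_def)
    show "\<exists>u\<in>Field ?r. \<forall>a\<in>C. (a, u) \<in> ?r"
    proof (cases "C = {}")
      case True
      then show ?thesis unfolding FR using assms by auto
    next
      case False
      have "eventually (\<lambda>_. False) (Inf C) \<longleftrightarrow> (\<exists>b\<in>C. eventually (\<lambda>_. False) b)"
      proof (rule eventually_Inf_base[OF False])
        fix a b assume "a \<in> C" "b \<in> C"
        then show "\<exists>x\<in>C. x \<le> inf a b" using lin[of a b] by (auto simp: inf_absorb1 inf_absorb2)
      qed
      then have "Inf C \<noteq> bot" using CS by (auto simp: trivial_limit_def)
      moreover have "Inf C \<le> F" using False CS by (auto intro: Inf_lower2)
      ultimately have "Inf C \<in> ?S" by blast
      then show ?thesis unfolding FR using CS by (auto intro!: bexI[of _ "Inf C"] Inf_lower)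
    qed
  qed
  then obtain M where M: "M \<noteq> bot" "M \<le> F" and min: "\<And>G. G \<noteq> bot \<Longrightarrow> G \<le> M \<Longrightarrow> G = M"
    unfolding FR by (auto intro: order_trans)
  have "ultrafilter M"
    unfolding ultrafilter_def
  proof (intro conjI allI M)
    fix P
    show "eventually P M \<or> eventually (\<lambda>x. \<not> P x) M"
    proof (rule disjCI)
      assume "\<not> eventually (\<lambda>x. \<not> P x) M"
      then have "inf M (principal {x. P x}) \<noteq> bot"
        by (simp add: trivial_limit_def eventually_inf_principal)
      from min[OF this] have "M \<le> principal {x. P x}" using inf_le2[of M "principal {x. P x}"] by simp
      then show "eventually P M" by (simp add: le_principal)
    qed
  qed
  then show ?thesis using that M by blast
qed

lemma stone_set_inter: "stone_set A \<inter> stone_set B = stone_set (A \<inter> B)"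
  by (auto simp: stone_set_def eventually_conj_iff)

lemma topspace_beta: "topspace \<beta>\<omega> = {U. ultrafilter U}"
proof -
  have "stone_set UNIV = {U. ultrafilter U}" by (simp add: stone_set_def)
  moreover have "stone_set A \<subseteq> stone_set UNIV" for A by (auto simp: stone_set_def)
  ultimately show ?thesis by (auto simp: \<beta>\<omega>_def)
qed

lemma openin_stone_set: "openin \<beta>\<omega> (stone_set A)"
  by (auto simp: \<beta>\<omega>_def intro: topology_generated_by_Basis)

lemma openin_beta:
  assumes "openin \<beta>\<omega> W" "U \<in> W"
  obtains A where "U \<in> stone_set A" "stone_set A \<subseteq> W"
proof -
  have "generate_topology_on (range stone_set) W"
    using assms(1) by (simp add: \<beta>\<omega>_def openin_topology_generated_by_iff)
  then have "U \<in> W \<Longrightarrow> \<exists>A. U \<in> stone_set A \<and> stone_set A \<subseteq> W" for U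
  proof induction
    case (Int a b)
    then obtain A B where "U \<in> stone_set A" "stone_set A \<subseteq> a" "U \<in> stone_set B" "stone_set B \<subseteq> b"
      by blast
    then have "U \<in> stone_set (A \<inter> B) \<and> stone_set (A \<inter> B) \<subseteq> a \<inter> b"
      unfolding stone_set_inter[symmetric] by auto
    then show ?case by blast
  qed blast+
  then show ?thesis using assms(2) that by blast
qed

lemma stone_set_Union: "finite \<C> \<Longrightarrow> stone_set (\<Union>\<C>) = (\<Union>A\<in>\<C>. stone_set A)"
proof (induction rule: finite_induct)
  case empty
  then show ?case by (auto simp: stone_set_def ultrafilter_def)
next
  case (insert A \<C>)
  have "stone_set (A \<union> B) = stone_set A \<union> stone_set B" for B
  proof
    show "stone_set (A \<union> B) \<subseteq> stone_set A \<union> stone_set B"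
    proof
      fix U assume "U \<in> stone_set (A \<union> B)"
      then have U: "ultrafilter U" and e: "\<forall>\<^sub>F n in U. n \<in> A \<union> B" by (auto simp: stone_set_def)
      have "eventually (\<lambda>n. n \<in> A) U \<or> eventually (\<lambda>n. n \<notin> A) U"
        using U unfolding ultrafilter_def by blast
      then have "eventually (\<lambda>n. n \<in> A) U \<or> eventually (\<lambda>n. n \<in> B) U"
        using eventually_elim2[OF _ e, of "\<lambda>n. n \<notin> A" "\<lambda>n. n \<in> B"] by blast
      then show "U \<in> stone_set A \<union> stone_set B" using U by (auto simp: stone_set_def)
    qed
  qed (auto simp: stone_set_def elim: eventually_mono)
  then show ?case using insert by simp
qed

theorem compact_beta: "compact_space \<beta>\<omega>"
  unfolding compact_space_alt
proof (intro allI impI, elim conjE)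
  fix \<U> assume op: "\<forall>U\<in>\<U>. openin \<beta>\<omega> U" and cov: "topspace \<beta>\<omega> \<subseteq> \<Union>\<U>"
  define \<B> where "\<B> = {A. \<exists>W\<in>\<U>. stone_set A \<subseteq> W}"
  define F where "F = (INF A\<in>\<B>. principal (- A))"
  have "F = bot"
  proof (rule ccontr)
    assume "F \<noteq> bot"
    then obtain U where U: "ultrafilter U" "U \<le> F" using ultrafilter_exists by blast
    then obtain W where W: "W \<in> \<U>" "U \<in> W" using cov by (auto simp: topspace_beta)
    then obtain A where A: "U \<in> stone_set A" "stone_set A \<subseteq> W" using op openin_beta by metis
    then have "A \<in> \<B>" using W by (auto simp: \<B>_def)
    then have "U \<le> principal (- A)" using U(2) by (auto simp: F_def le_INF_iff)
    then have "\<forall>\<^sub>F n in U. n \<notin> A" by (simp add: le_principal)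
    then show False using A U(1) ultrafilter_not[OF U(1), of "\<lambda>n. n \<in> A"] by (simp add: stone_set_def)
  qed
  then have "eventually (\<lambda>_. False) (INF A\<in>\<B>. principal (- A))" by (simp add: F_def)
  then obtain \<C> where C: "\<C> \<subseteq> \<B>" "finite \<C>" and ev: "eventually (\<lambda>_. False) (INF A\<in>\<C>. principal (- A))"
    unfolding eventually_INF[of _ _ \<B>] by (elim exE conjE)
  have "(INF A\<in>\<C>. principal (- A)) = principal (\<Inter>A\<in>\<C>. - A)"
    using C(2) by (rule INF_principal_finite)
  then have "\<Union>\<C> = UNIV" using ev by (auto simp: eventually_principal)
  then have all: "topspace \<beta>\<omega> \<subseteq> (\<Union>A\<in>\<C>. stone_set A)"
    using stone_set_Union[OF C(2)] by (simp add: topspace_beta stone_set_def)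
  obtain w where w: "\<And>A. A \<in> \<C> \<Longrightarrow> w A \<in> \<U> \<and> stone_set A \<subseteq> w A"
  proof -
    have "\<forall>A\<in>\<C>. \<exists>W. W \<in> \<U> \<and> stone_set A \<subseteq> W" using C(1) by (auto simp: \<B>_def)
    then show ?thesis by (rule bchoice[THEN exE]) (use that in blast)
  qed
  show "\<exists>\<F>. finite \<F> \<and> \<F> \<subseteq> \<U> \<and> topspace \<beta>\<omega> \<subseteq> \<Union>\<F>"
  proof (intro exI[of _ "w ` \<C>"] conjI)
    show "finite (w ` \<C>)" using C(2) by simp
    show "w ` \<C> \<subseteq> \<U>" using w by blast
    show "topspace \<beta>\<omega> \<subseteq> \<Union>(w ` \<C>)" using w all by blast
  qed
qed

theorem Hausdorff_beta: "Hausdorff_space \<beta>\<omega>"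
  unfolding Hausdorff_space_def
proof (intro allI impI)
  fix U V assume "U \<in> topspace \<beta>\<omega> \<and> V \<in> topspace \<beta>\<omega> \<and> U \<noteq> V"
  then have U: "ultrafilter U" and V: "ultrafilter V" and "U \<noteq> V" by (auto simp: topspace_beta)
  then have "\<not> V \<le> U \<or> \<not> U \<le> V" by auto
  then obtain Q where Q: "eventually Q U" "eventually (\<lambda>x. \<not> Q x) V"
  proof
    assume "\<not> V \<le> U"
    then obtain P where "eventually P U" "\<not> eventually P V" by (auto simp: le_filter_def)
    then show ?thesis using that[of P] ultrafilter_not[OF V, of P] by simp
  next
    assume "\<not> U \<le> V"
    then obtain P where "\<not> eventually P U" "eventually P V" by (auto simp: le_filter_def)
    then show ?thesis using that[of "\<lambda>x. \<not> P x"] ultrafilter_not[OF U, of P] by simp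
  qed
  have "disjnt (stone_set {x. Q x}) (stone_set {x. \<not> Q x})"
    using ultrafilter_not by (auto simp: disjnt_iff stone_set_def)
  then show "\<exists>W Z. openin \<beta>\<omega> W \<and> openin \<beta>\<omega> Z \<and> U \<in> W \<and> V \<in> Z \<and> disjnt W Z"
    using openin_stone_set[of "{x. Q x}"] openin_stone_set[of "{x. \<not> Q x}"] Q U V
    by (intro exI[of _ "stone_set {x. Q x}"] exI[of _ "stone_set {x. \<not> Q x}"])
      (simp add: stone_set_def[of "{x. Q x}"] stone_set_def[of "{x. \<not> Q x}"])
qed

lemma stone_set_singleton: "stone_set {n} = {principal {n}}"
proof -
  have "U = principal {n}" if "ultrafilter U" "\<forall>\<^sub>F k in U. k = n" for U
  proof (rule antisym)
    show "U \<le> principal {n}" using that(2) by (simp add: le_principal)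
    show "principal {n} \<le> U"
    proof (rule filter_leI)
      fix P assume P: "eventually P U"
      have "P n"
      proof (rule ccontr)
        assume "\<not> P n"
        then have "eventually (\<lambda>_. False) U"
          using eventually_elim2[OF P that(2), of "\<lambda>_. False"] by auto
        then show False using that(1) by (simp add: ultrafilter_def trivial_limit_def)
      qed
      then show "eventually P (principal {n})" by (simp add: eventually_principal)
    qed
  qed
  then show ?thesis using ultrafilter_principal by (auto simp: stone_set_def eventually_principal)
qed

theorem embedding_beta: "embedding_map (discrete_topology UNIV) \<beta>\<omega> (\<lambda>n. principal {n})"
proof (rule injective_open_imp_embedding_map)
  show "continuous_map (discrete_topology UNIV) \<beta>\<omega> (\<lambda>n. principal {n})"
    by (auto simp: topspace_beta ultrafilter_principal)
  have "openin \<beta>\<omega> (\<Union>n\<in>A. stone_set {n})" for A by (intro openin_Union) (auto simp: openin_stone_set)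
  then show "open_map (discrete_topology UNIV) \<beta>\<omega> (\<lambda>n. principal {n})"
    by (simp add: open_map_def stone_set_singleton UNION_singleton_eq_range)
  show "inj_on (\<lambda>n. principal {n}) (topspace (discrete_topology (UNIV :: nat set)))"
    by (auto simp: inj_on_def)
qed

theorem dense_beta: "\<beta>\<omega> closure_of range (\<lambda>n. principal {n}) = topspace \<beta>\<omega>"
proof (rule antisym[OF closure_of_subset_topspace], rule subsetI)
  fix U assume U: "U \<in> topspace \<beta>\<omega>"
  have "\<exists>n. principal {n} \<in> W" if W: "openin \<beta>\<omega> W" "U \<in> W" for W
  proof -
    obtain A where A: "U \<in> stone_set A" "stone_set A \<subseteq> W" using W openin_beta by blast
    then have "A \<noteq> {}" by (auto simp: stone_set_def ultrafilter_def)
    then obtain n where "n \<in> A" by blast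
    then have "principal {n} \<in> stone_set A"
      by (simp add: stone_set_def ultrafilter_principal eventually_principal)
    then show ?thesis using A by blast
  qed
  then show "U \<in> \<beta>\<omega> closure_of range (\<lambda>n. principal {n})"
    using U by (auto simp: in_closure_of)
qed

theorem extension_beta:
  fixes K :: "'k topology" and f :: "nat \<Rightarrow> 'k"
  assumes K: "compact_space K" "Hausdorff_space K" and f: "range f \<subseteq> topspace K"
  obtains g where "continuous_map \<beta>\<omega> K g" "\<And>n. g (principal {n}) = f n"
proof -
  have ex: "\<exists>l. limitin K f l U" if U: "ultrafilter U" for U
  proof (rule ccontr)
    assume "\<nexists>l. limitin K f l U"
    then have "\<forall>l\<in>topspace K. \<exists>W. openin K W \<and> l \<in> W \<and> \<not> (\<forall>\<^sub>F n in U. f n \<in> W)"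
      by (auto simp: limitin_def)
    then obtain w where w: "\<And>l. l \<in> topspace K \<Longrightarrow> openin K (w l) \<and> l \<in> w l \<and> \<not> (\<forall>\<^sub>F n in U. f n \<in> w l)"
      by metis
    have "\<exists>\<F>. finite \<F> \<and> \<F> \<subseteq> w ` topspace K \<and> topspace K \<subseteq> \<Union>\<F>"
      using K(1)[unfolded compact_space_alt, rule_format, of "w ` topspace K"] w by blast
    then obtain \<F> where F: "finite \<F>" "\<F> \<subseteq> w ` topspace K" "topspace K \<subseteq> \<Union>\<F>" by blast
    have "\<forall>W\<in>\<F>. \<forall>\<^sub>F n in U. f n \<notin> W"
    proof
      fix W assume "W \<in> \<F>"
      then have "\<not> (\<forall>\<^sub>F n in U. f n \<in> W)" using F(2) w by blast
      then show "\<forall>\<^sub>F n in U. f n \<notin> W" using ultrafilter_not[OF U, of "\<lambda>n. f n \<in> W"] by simp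
    qed
    then have "\<forall>\<^sub>F n in U. \<forall>W\<in>\<F>. f n \<notin> W" using F(1) by (simp add: eventually_ball_finite)
    then have "\<forall>\<^sub>F n in U. False" by (rule eventually_mono) (use F(3) f in blast)
    then show False using U by (simp add: ultrafilter_def trivial_limit_def)
  qed
  define g where "g U = (SOME l. limitin K f l U)" for U
  have g: "limitin K f (g U) U" if "ultrafilter U" for U
    using ex[OF that] unfolding g_def by (rule someI_ex)
  have g_closed: "g U \<in> C" if U: "ultrafilter U" and C: "closedin K C" and e: "\<forall>\<^sub>F n in U. f n \<in> C" for U C
  proof (rule ccontr)
    assume "g U \<notin> C"
    then have "\<forall>\<^sub>F n in U. f n \<in> topspace K - C"
      using g[OF U] openin_diff[OF openin_topspace C] unfolding limitin_def by blast
    then have "\<forall>\<^sub>F n in U. f n \<notin> C" by (rule eventually_mono) auto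
    then show False using e ultrafilter_not[OF U, of "\<lambda>n. f n \<in> C"] by simp
  qed
  have "continuous_map \<beta>\<omega> K g"
    unfolding continuous_map_def
  proof (intro conjI allI impI)
    show "g \<in> topspace \<beta>\<omega> \<rightarrow> topspace K" using g by (auto simp: topspace_beta limitin_def)
  next
    fix W assume W: "openin K W"
    show "openin \<beta>\<omega> {U \<in> topspace \<beta>\<omega>. g U \<in> W}"
    proof (subst openin_subopen, intro ballI)
      fix U assume "U \<in> {U \<in> topspace \<beta>\<omega>. g U \<in> W}"
      then have U: "ultrafilter U" "g U \<in> W" by (auto simp: topspace_beta)
      have "regular_space K" using K compact_Hausdorff_imp_regular_space by blast
      then have "neighbourhood_base_of (closedin K) K" by (simp add: neighbourhood_base_of_closedin)
      then have "\<exists>V C. openin K V \<and> closedin K C \<and> g U \<in> V \<and> V \<subseteq> C \<and> C \<subseteq> W"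
        using W U(2) by (simp add: neighbourhood_base_of)
      then obtain V C where VC: "openin K V" "closedin K C" "g U \<in> V" "V \<subseteq> C" "C \<subseteq> W"
        by (elim exE conjE)
      have "U \<in> stone_set (f -` V)"
        using U(1) g[OF U(1)] VC by (auto simp: stone_set_def limitin_def)
      moreover have "stone_set (f -` V) \<subseteq> {U \<in> topspace \<beta>\<omega>. g U \<in> W}"
      proof
        fix U' assume "U' \<in> stone_set (f -` V)"
        then have U': "ultrafilter U'" "\<forall>\<^sub>F n in U'. f n \<in> V" by (auto simp: stone_set_def)
        then have "\<forall>\<^sub>F n in U'. f n \<in> C" using VC(4) by (auto elim: eventually_mono)
        then show "U' \<in> {U \<in> topspace \<beta>\<omega>. g U \<in> W}"
          using g_closed[OF U'(1) VC(2)] VC(5) U'(1) by (auto simp: topspace_beta)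
      qed
      ultimately show "\<exists>T. openin \<beta>\<omega> T \<and> U \<in> T \<and> T \<subseteq> {U \<in> topspace \<beta>\<omega>. g U \<in> W}"
        using openin_stone_set by blast
    qed
  qed
  moreover have "g (principal {n}) = f n" for n
  proof -
    have "limitin K f (f n) (principal {n})"
      using f by (auto simp: limitin_def eventually_principal)
    then show ?thesis
      using g[OF ultrafilter_principal] K(2) limitin_Hausdorff_unique
      by (metis ultrafilter_principal ultrafilter_def)
  qed
  ultimately show ?thesis using that by blast
qed

end

theory Submission
  imports Defs "HOL-Library.Bourbaki_Witt_Fixpoint"
begin

text \<open>Completeness: let \<open>w\<^sub>0\<close> be a maximal consistent set refuting \<open>\<phi>\<close>. By the axiom of S4.1.2 the canonical
  frame above \<open>w\<^sub>0\<close> has a single final world; it labels the principal ultrafilters. A free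
  ultrafilter is labelled by following a transfinite path. At each stage there is an intersection
  of clopen sets carrying a set of boxed formulas, and a completely separable MAD family splits off
  disjoint clopen children carrying strictly larger sets of boxed formulas. The path of an
  ultrafilter enters the child containing it, if any, and otherwise stops, the ultrafilter then
  being labelled by a world of the current cluster. Complete separability gives every
  neighbourhood of a stopped ultrafilter continuum many children and continuum many stopped
  ultrafilters, so that by a disjoint refinement all required labels occur in every neighbourhood.
  As the sets of boxed formulas increase strictly and there are only countably many formulas,
  every path has countable cofinality. At a limit stage the differences of a cofinal sequence are
  identified with pieces of countably many members of the MAD family, and the remaining members
  provide the children. Since infinite \<open>\<Gamma>\<close> are allowed, finite frames would not suffice.\<close>

section \<open>Disjoint refinement\<close>

text \<open>The intersection met at a limit stage is closed but no longer clopen, so an almost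
  disjoint family on \<open>nat\<close> does not fit it directly. Both kinds of stage are therefore
  treated by one device: an injection \<open>\<sigma>\<close> of a set \<open>A\<^sub>0\<close> into
  \<open>nat\<close>, such that the free ultrafilters of the stage are those containing
  \<open>A\<^sub>0\<close> and avoiding the preimages of certain selected members of the family.
  With a least set nothing has to be selected. An ultrafilter that stops avoids the remaining
  preimages too, hence the preimage of the whole ideal, and so each of its neighbourhoods has an
  image to which complete separability applies. What can be entered from a history depends on the
  history alone. Ultrafilters containing a set entered along one path therefore share that path up
  to this set, which makes boxed formulas true on whole clopen sets. Conversely, a formula failing
  at a world above a label is refuted nearby by an ultrafilter that stops at the same stage or after
  exactly one further step, so a failure never has to be carried through a limit.\<close>

lemma disjoint_refinement:
  includes cardinal_syntax
  fixes S :: "'i \<Rightarrow> 'a set"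
  assumes "\<And>i. |UNIV :: 'i set| \<le>o |S i|"
  obtains f where "inj f" "\<And>i. f i \<in> S i"
proof -
  define r where "r = |UNIV :: 'i set|"
  have Fr: "Field r = UNIV" by (simp add: r_def Field_card_of)
  have Cr: "Card_order r" by (simp add: r_def card_of_Card_order)
  then have wo: "wo_rel r" using card_order_on_well_order_on unfolding wo_rel_def by blast
  have wf: "wf (r - Id)" using wo_rel.WF[OF wo] .
  define G where "G = (\<lambda>(f :: 'i \<Rightarrow> 'a) i. SOME y. y \<in> S i \<and> (\<forall>j. (j, i) \<in> r - Id \<longrightarrow> y \<noteq> f j))"
  define f where "f = wfrec (r - Id) G"
  have unfold: "f i = (SOME y. y \<in> S i \<and> (\<forall>j. (j, i) \<in> r - Id \<longrightarrow> y \<noteq> f j))" for i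
  proof -
    have "f i = G (cut f (r - Id) i) i" unfolding f_def by (rule wfrec[OF wf])
    then show ?thesis by (simp add: G_def cut_def cong: imp_cong)
  qed
  have f: "f i \<in> S i \<and> (\<forall>j. (j, i) \<in> r - Id \<longrightarrow> f i \<noteq> f j)" for i
  proof -
    \<comment> \<open>Proper initial segments of a cardinal order have smaller cardinality, so the
      values chosen earlier cannot exhaust \<open>S i\<close>.\<close>
    have "|f ` underS r i| \<le>o |underS r i|" by (rule card_of_image)
    also have "|underS r i| <o r" using Cr by (rule card_of_underS) (simp add: Fr)
    also (ordLeq_ordLess_trans) have "r \<le>o |S i|" unfolding r_def by (rule assms)
    finally (ordLess_ordLeq_trans) have "|f ` underS r i| <o |S i|" .
    then have "\<not> S i \<subseteq> f ` underS r i" using card_of_mono1 not_ordLess_ordLeq by blast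
    then have "\<exists>y. y \<in> S i \<and> (\<forall>j. (j, i) \<in> r - Id \<longrightarrow> y \<noteq> f j)" by (auto simp: underS_def)
    then show ?thesis unfolding unfold[of i] by (rule someI_ex)
  qed
  have "inj f"
  proof (rule injI, rule ccontr)
    fix i j assume "f i = f j" "i \<noteq> j"
    moreover have "(i, j) \<in> r \<or> (j, i) \<in> r"
      using wo_rel.TOTALS[OF wo] by (simp add: Fr)
    ultimately show False using f[of i] f[of j] by auto
  qed
  then show ?thesis using f that by blast
qed

text \<open>The pairs of a neighbourhood and a colour embed into \<open>nat set\<close>, so disjoint
  refinement serves all of them with distinct points; the colour of a point is read off the pair
  that it serves.\<close>

lemma dense_labelling:
  includes cardinal_syntax
  fixes S :: "nat set \<Rightarrow> 'a set"
  assumes "\<And>X. X \<in> \<P> \<Longrightarrow> \<exists>g :: nat set \<Rightarrow> 'a. inj g \<and> range g \<subseteq> S X"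
  obtains c :: "'a \<Rightarrow> nat" where "\<And>X k. X \<in> \<P> \<Longrightarrow> \<exists>y\<in>S X. c y = k"
proof (cases "\<P> = {}")
  case True
  then show ?thesis using that by blast
next
  case False
  then obtain X\<^sub>0 where X0: "X\<^sub>0 \<in> \<P>" by blast
  \<comment> \<open>\<open>X\<^sub>0\<close> is a default that keeps \<open>S'\<close> large at
    every index.\<close>
  define S' where "S' = (\<lambda>(X, k :: nat). S (if X \<in> \<P> then X else X\<^sub>0))"
  \<comment> \<open>The only even element records the number, the odd ones form a copy of the
    set.\<close>
  define e where "e = (\<lambda>(X, k). insert (2 * k) ((\<lambda>n. 2 * n + 1) ` X) :: nat set)"
  have ne: "Suc (2 * a) \<noteq> 2 * b" for a b :: nat by presburger
  have e1: "n \<in> X \<longleftrightarrow> 2 * n + 1 \<in> e (X, k)" for n X k by (auto simp: e_def ne)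
  have e2: "n = k \<longleftrightarrow> 2 * n \<in> e (X, k)" for n X k by (auto simp: e_def ne[symmetric])
  have "inj e"
  proof (rule injI)
    fix p q :: "nat set \<times> nat" assume "e p = e q"
    then show "p = q" using e1[of _ "fst p" "snd p"] e1[of _ "fst q" "snd q"]
        e2[of _ "snd p" "fst p"] e2[of _ "snd q" "fst q"]
      by (metis prod.collapse subsetI subset_antisym)
  qed
  have "|UNIV :: (nat set \<times> nat) set| \<le>o |S' i|" for i
  proof -
    have "(if fst i \<in> \<P> then fst i else X\<^sub>0) \<in> \<P>" using X0 by simp
    then have "\<exists>g :: nat set \<Rightarrow> 'a. inj g \<and> range g \<subseteq> S' i"
      using assms[of "if fst i \<in> \<P> then fst i else X\<^sub>0"] by (simp add: S'_def case_prod_beta)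
    then obtain g :: "nat set \<Rightarrow> 'a" where "inj g" "range g \<subseteq> S' i" by blast
    then have "inj (g \<circ> e)" "range (g \<circ> e) \<subseteq> S' i" using \<open>inj e\<close> by (auto intro: inj_compose)
    then show ?thesis by (metis card_of_ordLeq)
  qed
  then obtain f where f: "inj f" "\<And>i. f i \<in> S' i" using disjoint_refinement by metis
  show ?thesis
  proof (rule that[of "\<lambda>y. snd (inv f y)"])
    fix X k assume "X \<in> \<P>"
    then show "\<exists>y\<in>S X. snd (inv f y) = k"
      using f(2)[of "(X, k)"] f(1) by (intro bexI[of _ "f (X, k)"]) (auto simp: S'_def)
  qed
qed

section \<open>Ultrafilters and completely separable MAD families\<close>

definition members :: "'a filter \<Rightarrow> 'a set set" where
  "members U = {A. \<forall>\<^sub>F n in U. n \<in> A}"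

lemma members_mono: "A \<in> members U \<Longrightarrow> A \<subseteq> B \<Longrightarrow> B \<in> members U"
  by (auto simp: members_def elim: eventually_mono)

lemma members_Int: "A \<inter> B \<in> members U \<longleftrightarrow> A \<in> members U \<and> B \<in> members U"
  by (auto simp: members_def eventually_conj_iff)

lemma members_Compl: "ultrafilter U \<Longrightarrow> - A \<in> members U \<longleftrightarrow> A \<notin> members U"
  using ultrafilter_not[of U "\<lambda>n. n \<in> A"] by (simp add: members_def)

lemma members_Diff: "ultrafilter U \<Longrightarrow> A - B \<in> members U \<longleftrightarrow> A \<in> members U \<and> B \<notin> members U"
  by (simp add: Diff_eq members_Int members_Compl)

lemma members_Un: "ultrafilter U \<Longrightarrow> A \<union> B \<in> members U \<longleftrightarrow> A \<in> members U \<or> B \<in> members U"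
  using members_Compl[of U "A \<union> B"] by (simp add: members_Int members_Compl) blast

lemma stone_set_members: "stone_set A = {U. ultrafilter U \<and> A \<in> members U}"
  by (simp add: stone_set_def members_def)

text \<open>As \<open>J\<close> is an ideal, the sets \<open>Y - Z\<close> with \<open>Z\<close> in
  \<open>J\<close> form a filter base, and none is empty because \<open>Y\<close> is outside
  \<open>J\<close>.\<close>

lemma ultrafilter_avoiding:
  assumes un: "\<And>Z Z'. Z \<in> J \<Longrightarrow> Z' \<in> J \<Longrightarrow> Z \<union> Z' \<in> J"
    and sub: "\<And>Z Z'. Z \<in> J \<Longrightarrow> Z' \<subseteq> Z \<Longrightarrow> Z' \<in> J"
    and ne: "{} \<in> J" and Y: "Y \<notin> J"
  obtains U where "ultrafilter U" "Y \<in> members U" "\<And>Z. Z \<in> J \<Longrightarrow> Z \<notin> members U"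
proof -
  define F where "F = (INF Z\<in>J. principal (Y - Z))"
  have ev: "eventually P F \<longleftrightarrow> (\<exists>Z\<in>J. eventually P (principal (Y - Z)))" for P
    unfolding F_def
  proof (rule eventually_INF_base)
    fix Z Z' assume "Z \<in> J" "Z' \<in> J"
    then show "\<exists>W\<in>J. principal (Y - W) \<le> inf (principal (Y - Z)) (principal (Y - Z'))"
      using un by (intro bexI[of _ "Z \<union> Z'"]) auto
  qed (use ne in auto)
  have "F \<noteq> bot"
  proof
    assume "F = bot"
    then obtain Z where "Z \<in> J" "Y \<subseteq> Z" using ev[of "\<lambda>_. False"] by (auto simp: eventually_principal)
    then show False using sub Y by blast
  qed
  then obtain U where U: "ultrafilter U" "U \<le> F" using ultrafilter_exists by blast
  have "Y - Z \<in> members U" if "Z \<in> J" for Z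
  proof -
    have "eventually (\<lambda>n. n \<in> Y - Z) F" unfolding ev using that by (auto simp: eventually_principal)
    then show ?thesis using U(2) by (auto simp: members_def le_filter_def)
  qed
  then show ?thesis using that[of U] U(1) ne members_Diff[OF U(1)] by blast
qed

definition free_ultrafilter :: "'a filter \<Rightarrow> bool" where
  "free_ultrafilter U \<longleftrightarrow> ultrafilter U \<and> (\<forall>A. finite A \<longrightarrow> A \<notin> members U)"

lemma nonfree_ultrafilter_principal:
  fixes U :: "nat filter"
  assumes "ultrafilter U" "\<not> free_ultrafilter U"
  obtains n where "U = principal {n}"
proof -
  obtain A where A: "finite A" "A \<in> members U" using assms by (auto simp: free_ultrafilter_def)
  then have "U \<in> stone_set (\<Union>n\<in>A. {n})" using assms by (simp add: stone_set_members)
  then obtain n where "U \<in> stone_set {n}" using stone_set_Union[of "(\<lambda>n. {n}) ` A"] A(1) by auto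
  then show ?thesis using that by (simp add: stone_set_singleton)
qed

definition almost_subset :: "'a set \<Rightarrow> 'a set \<Rightarrow> bool" (infix "\<subseteq>\<^sup>*" 50) where
  "A \<subseteq>\<^sup>* B \<longleftrightarrow> finite (A - B)"

text \<open>On free ultrafilters this is strict inclusion of the clopen sets given by
  \<open>A\<close> and \<open>B\<close>, as an infinite difference belongs to some free
  ultrafilter.\<close>

definition almost_psubset :: "'a set \<Rightarrow> 'a set \<Rightarrow> bool" (infix "\<subset>\<^sup>*" 50) where
  "A \<subset>\<^sup>* B \<longleftrightarrow> finite (A - B) \<and> infinite (B - A)"

lemma almost_psubset_imp_subset: "A \<subset>\<^sup>* B \<Longrightarrow> A \<subseteq>\<^sup>* B"
  by (simp add: almost_subset_def almost_psubset_def)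

lemma almost_subset_trans: "A \<subseteq>\<^sup>* B \<Longrightarrow> B \<subseteq>\<^sup>* C \<Longrightarrow> A \<subseteq>\<^sup>* C"
  unfolding almost_subset_def by (rule finite_subset[of _ "(A - B) \<union> (B - C)"]) auto

lemma almost_psubset_trans1: "A \<subset>\<^sup>* B \<Longrightarrow> B \<subseteq>\<^sup>* C \<Longrightarrow> A \<subset>\<^sup>* C"
proof -
  assume A: "A \<subset>\<^sup>* B" and C: "B \<subseteq>\<^sup>* C"
  have "B - A \<subseteq> (B - C) \<union> (C - A)" by blast
  then have "infinite (C - A)" using A C
    by (meson almost_psubset_def almost_subset_def finite_UnI finite_subset)
  then show ?thesis using almost_subset_trans[OF almost_psubset_imp_subset[OF A] C]
    by (simp add: almost_subset_def almost_psubset_def)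
qed

lemma members_almost_mono:
  "free_ultrafilter U \<Longrightarrow> A \<in> members U \<Longrightarrow> A \<subseteq>\<^sup>* B \<Longrightarrow> B \<in> members U"
  using members_Diff[of U A B] by (auto simp: free_ultrafilter_def almost_subset_def)

lemma members_finite_Int:
  "free_ultrafilter U \<Longrightarrow> A \<in> members U \<Longrightarrow> finite (A \<inter> B) \<Longrightarrow> B \<notin> members U"
  using members_Int[of A B U] by (auto simp: free_ultrafilter_def)

lemma infinite_halves:
  assumes "infinite (A :: nat set)"
  obtains D where "D \<subseteq> A" "infinite D" "infinite (A - D)"
proof -
  obtain C :: "nat \<Rightarrow> nat set" where C: "pairwise (\<lambda>i j. disjnt (C i) (C j)) UNIV" "\<Union>(range C) \<subseteq> A"
    "\<And>i. infinite (C i)"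
    using infinite_infinite_partition[OF assms] by metis
  have "C 1 \<subseteq> A - C 0" using C(1,2) by (fastforce simp: pairwise_def disjnt_iff)
  then have "infinite (A - C 0)" using C(3) finite_subset by blast
  then show ?thesis using that[of "C 0"] C by blast
qed

text \<open>These are the branches of the binary tree: \<open>M s\<close> codes the initial segments
  of \<open>s\<close>, and two sets share only the segments before their first difference.\<close>

lemma continuum_almost_disjoint:
  obtains M :: "nat set \<Rightarrow> nat set"
  where "\<And>s. infinite (M s)" "\<And>s t. s \<noteq> t \<Longrightarrow> finite (M s \<inter> M t)"
proof
  \<comment> \<open>The length is coded too, since one finite set can be a segment for several
    lengths.\<close>
  define c where "c s n = prod_encode (n, set_encode (s \<inter> {..<n}))" for s n
  show "infinite (range (c s))" for s
    by (rule range_inj_infinite) (auto simp: inj_def c_def)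
  show "finite (range (c s) \<inter> range (c t))" if "s \<noteq> t" for s t
  proof -
    obtain k where k: "k \<in> s \<longleftrightarrow> k \<notin> t" using \<open>s \<noteq> t\<close> by blast
    have "range (c s) \<inter> range (c t) \<subseteq> c s ` {..k}"
    proof (intro subsetI)
      fix x assume "x \<in> range (c s) \<inter> range (c t)"
      then obtain n where n: "x = c s n" "c s n = c t n" by (auto simp: c_def)
      then have "s \<inter> {..<n} = t \<inter> {..<n}"
        by (metis (no_types, lifting) c_def finite_Int finite_lessThan prod.inject prod_encode_eq set_encode_eq)
      then have "n \<le> k" using k by (auto simp: not_less[symmetric])
      then show "x \<in> c s ` {..k}" using n by blast
    qed
    then show ?thesis by (rule finite_subset) simp
  qed
qed

section \<open>Sets outside the ideal of a completely separable MAD family\<close>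

locale separable_mad =
  fixes \<A> :: "nat set set"
  assumes mad: "MAD_family \<A>" and separable: "completely_separable \<A>"
begin

lemma infinite_member: "A \<in> \<A> \<Longrightarrow> infinite A"
  using mad by (simp add: MAD_family_def AD_family_def)

lemma finite_inter: "A \<in> \<A> \<Longrightarrow> B \<in> \<A> \<Longrightarrow> A \<noteq> B \<Longrightarrow> finite (A \<inter> B)"
  using mad by (simp add: MAD_family_def AD_family_def)

lemma infinite_family: "infinite \<A>"
  using mad by (simp add: MAD_family_def)

abbreviation (input) small :: "nat set set" where "small \<equiv> ideal_generated \<A>"

text \<open>Used as a test: a set meeting infinitely many members in infinite sets is outside the
  ideal.\<close>

lemma small_meets_finitely_many: "X \<in> small \<Longrightarrow> finite {A \<in> \<A>. infinite (X \<inter> A)}"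
proof (induction rule: ideal_generated.induct)
  case (member A)
  have "{B \<in> \<A>. infinite (A \<inter> B)} \<subseteq> {A}" using finite_inter member by blast
  then show ?case by (rule finite_subset) simp
next
  case (union X Y)
  have "{A \<in> \<A>. infinite ((X \<union> Y) \<inter> A)} \<subseteq> {A \<in> \<A>. infinite (X \<inter> A)} \<union> {A \<in> \<A>. infinite (Y \<inter> A)}"
    by (auto simp: Int_Un_distrib2)
  then show ?case using union by (meson finite_UnI finite_subset)
next
  case (subset X Y)
  have "{A \<in> \<A>. infinite (Y \<inter> A)} \<subseteq> {A \<in> \<A>. infinite (X \<inter> A)}"
    using subset(2) by (auto intro: finite_subset[of "Y \<inter> _" "X \<inter> _"])
  then show ?case using subset by (meson finite_subset)
qed auto

lemma UNIV_not_small: "UNIV \<notin> small"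
proof
  assume "UNIV \<in> small"
  moreover have "{A \<in> \<A>. infinite (UNIV \<inter> A)} = \<A>" using infinite_member by auto
  ultimately show False using small_meets_finitely_many infinite_family by metis
qed

lemma Union_small: "finite I \<Longrightarrow> (\<And>i. i \<in> I \<Longrightarrow> X i \<in> small) \<Longrightarrow> (\<Union>i\<in>I. X i) \<in> small"
  by (induction I rule: finite_induct) (auto intro: ideal_generated.intros)

text \<open>Maximality provides a member meeting \<open>X\<close> in an infinite set, as otherwise
  \<open>X\<close> could be added to the family. This rules out the first alternative of complete
  separability.\<close>

lemma large_contains_member:
  assumes "X \<notin> small"
  obtains A where "A \<in> \<A>" "A \<subseteq>\<^sup>* X"
proof -
  have "\<exists>A\<in>\<A>. infinite (X \<inter> A)"
  proof (rule ccontr)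
    assume no: "\<not> ?thesis"
    have "infinite X" using assms ideal_generated.finite by blast
    then have "AD_family (insert X \<A>)" using no infinite_member finite_inter
      unfolding AD_family_def by (auto simp: Int_commute)
    then have "insert X \<A> = \<A>" using mad unfolding MAD_family_def by blast
    then show False using assms ideal_generated.member by blast
  qed
  then show ?thesis using separable assms that unfolding completely_separable_def almost_subset_def by blast
qed

text \<open>Were there finitely many, removing their union from \<open>X\<close> would leave a set
  outside the ideal; a member almost contained in that set is itself one of those removed.\<close>

lemma large_contains_infinitely_many:
  assumes "X \<notin> small"
  shows "infinite {A \<in> \<A>. A \<subseteq>\<^sup>* X}"
proof
  assume fin: "finite {A \<in> \<A>. A \<subseteq>\<^sup>* X}"
  define Z where "Z = \<Union>{A \<in> \<A>. A \<subseteq>\<^sup>* X}"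
  have "Z \<in> small" using Union_small[OF fin, of "\<lambda>A. A"] ideal_generated.member by (auto simp: Z_def)
  then have "X - Z \<notin> small" using assms ideal_generated.union[of "X - Z" \<A> Z]
    by (metis Un_Diff_cancel2 Un_upper1 ideal_generated.subset)
  then obtain A where A: "A \<in> \<A>" "A \<subseteq>\<^sup>* X - Z" by (rule large_contains_member)
  then have "A \<subseteq>\<^sup>* X" by (auto simp: almost_subset_def elim: finite_subset[rotated])
  then have "A \<subseteq> Z" using A by (auto simp: Z_def)
  then have "A - (X - Z) = A" by blast
  then show False using A infinite_member by (simp add: almost_subset_def)
qed

lemma infinite_disjointed:
  fixes a :: "nat \<Rightarrow> nat set"
  assumes "inj a" and a: "\<And>i. a i \<in> \<A>"
  shows "infinite (a i - (\<Union>j<i. a j))"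
proof
  assume "finite (a i - (\<Union>j<i. a j))"
  moreover have "finite (a i \<inter> a j)" if "j < i" for j
    using that finite_inter[OF a a] \<open>inj a\<close> by (simp add: inj_eq)
  then have "finite (\<Union>j<i. a i \<inter> a j)" by blast
  moreover have "a i \<subseteq> (a i - (\<Union>j<i. a j)) \<union> (\<Union>j<i. a i \<inter> a j)" by blast
  ultimately show False using infinite_member[OF a] by (meson finite_UnI finite_subset)
qed

text \<open>Countably many members almost contained in \<open>X\<close> are made disjoint, and
  pieces of them are united along continuum many almost disjoint index sets. Two such unions share
  only finitely many pieces. The third conclusion later separates ultrafilters, the fourth separates
  members of \<open>\<A>\<close>.\<close>

lemma large_splits:
  assumes X: "X \<notin> small"
  obtains Y :: "nat set \<Rightarrow> nat set"
  where "\<And>s. Y s \<subseteq> X" "\<And>s. Y s \<notin> small" "\<And>s t. s \<noteq> t \<Longrightarrow> Y s \<inter> Y t \<in> small"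
    "\<And>s t A. s \<noteq> t \<Longrightarrow> A \<in> \<A> \<Longrightarrow> \<not> A \<subseteq>\<^sup>* Y s \<inter> Y t"
proof -
  obtain a :: "nat \<Rightarrow> nat set" where inj: "inj a" and "range a \<subseteq> {A \<in> \<A>. A \<subseteq>\<^sup>* X}"
    using infinite_countable_subset[OF large_contains_infinitely_many[OF X]] by blast
  then have a: "a i \<in> \<A>" "finite (a i - X)" for i by (auto simp: almost_subset_def)
  define b where "b i = X \<inter> a i - (\<Union>j<i. a j)" for i
  have "infinite (b i)" for i
  proof
    assume "finite (b i)"
    moreover have "a i - (\<Union>j<i. a j) \<subseteq> b i \<union> (a i - X)" by (auto simp: b_def)
    ultimately show False using a(2) infinite_disjointed[OF inj a(1)] by (meson finite_UnI finite_subset)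
  qed
  \<comment> \<open>Keeping only half of \<open>b i\<close> prevents the \<open>a i\<close> from being almost contained in \<open>Y s \<inter> Y t\<close>.\<close>
  then have "\<exists>D. D \<subseteq> b i \<and> infinite D \<and> infinite (b i - D)" for i using infinite_halves by metis
  then obtain D where D: "\<And>i. D i \<subseteq> b i" "\<And>i. infinite (D i)" "\<And>i. infinite (b i - D i)" by metis
  have bdisj: "b i \<inter> b j = {}" if "i \<noteq> j" for i j
    using that by (cases "i < j") (auto simp: b_def)
  obtain M :: "nat set \<Rightarrow> nat set" where M: "\<And>s. infinite (M s)" "\<And>s t. s \<noteq> t \<Longrightarrow> finite (M s \<inter> M t)"
    using continuum_almost_disjoint by blast
  define Y where "Y s = (\<Union>i\<in>M s. D i)" for s
  have Yint: "Y s \<inter> Y t \<subseteq> (\<Union>i\<in>M s \<inter> M t. D i)" for s t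
  proof
    fix x assume "x \<in> Y s \<inter> Y t"
    then obtain i j where "i \<in> M s" "x \<in> D i" "j \<in> M t" "x \<in> D j" by (auto simp: Y_def)
    moreover from this have "i = j" using D(1)[of i] D(1)[of j] bdisj[of i j] by blast
    ultimately show "x \<in> (\<Union>i\<in>M s \<inter> M t. D i)" by blast
  qed
  have Da: "D i \<subseteq> a i" for i using D(1) by (auto simp: b_def)
  show ?thesis
  proof
    show "Y s \<subseteq> X" for s using D(1) by (auto simp: Y_def b_def)
    show "Y s \<notin> small" for s
    proof
      assume "Y s \<in> small"
      then have fin: "finite {A \<in> \<A>. infinite (Y s \<inter> A)}" by (rule small_meets_finitely_many)
      have "infinite (Y s \<inter> a i)" if "i \<in> M s" for i
        using D(2)[of i] Da[of i] that finite_subset[of "D i" "Y s \<inter> a i"] by (auto simp: Y_def)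
      then have "a ` M s \<subseteq> {A \<in> \<A>. infinite (Y s \<inter> A)}" using a by blast
      then have "finite (a ` M s)" using fin finite_subset by blast
      then show False using M(1) inj finite_imageD inj_on_subset by blast
    qed
    fix s t :: "nat set" assume st: "s \<noteq> t"
    show "Y s \<inter> Y t \<in> small"
    proof (rule ideal_generated.subset[OF Union_small[OF M(2)[OF st], of D] Yint])
      show "D i \<in> small" for i using Da a ideal_generated.subset ideal_generated.member by blast
    qed
    fix A assume A: "A \<in> \<A>"
    show "\<not> A \<subseteq>\<^sup>* Y s \<inter> Y t"
    proof
      assume "A \<subseteq>\<^sup>* Y s \<inter> Y t"
      then have fin: "finite (A - Y s \<inter> Y t)" by (simp add: almost_subset_def)
      \<comment> \<open>Almost all of \<open>A\<close> lies in finitely many common pieces, so it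
        meets one of them infinitely and must be the corresponding \<open>a i\<close>.\<close>
      have "infinite (A \<inter> (\<Union>i\<in>M s \<inter> M t. D i))"
      proof
        assume "finite (A \<inter> (\<Union>i\<in>M s \<inter> M t. D i))"
        moreover have "A \<subseteq> (A - Y s \<inter> Y t) \<union> (A \<inter> (\<Union>i\<in>M s \<inter> M t. D i))" using Yint by blast
        ultimately show False using fin infinite_member[OF A] by (meson finite_UnI finite_subset)
      qed
      then have "\<not> (\<forall>i\<in>M s \<inter> M t. finite (A \<inter> D i))"
        using M(2)[OF st] by (simp only: Int_UN_distrib finite_UN not_False_eq_True)
      then obtain i where i: "infinite (A \<inter> D i)" by blast
      then have "infinite (A \<inter> a i)" using Da finite_subset[of "A \<inter> D i" "A \<inter> a i"] by blast
      then have "A = a i" using A a finite_inter by blast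
      have "b i - D i \<subseteq> A - Y s \<inter> Y t"
      proof
        fix x assume x: "x \<in> b i - D i"
        have "x \<notin> D j" for j using x D(1)[of j] bdisj[of i j] by (cases "i = j") auto
        then have "x \<notin> Y s" by (simp add: Y_def)
        then show "x \<in> A - Y s \<inter> Y t" using x \<open>A = a i\<close> by (simp add: b_def)
      qed
      then show False using fin D(3) finite_subset by blast
    qed
  qed
qed

end

section \<open>Stages of the construction\<close>

text \<open>Where paths stop if \<open>\<B>\<close> are the sets that can be entered from
  \<open>\<H>\<close>.\<close>

definition remainder :: "nat set set \<Rightarrow> nat set set \<Rightarrow> nat filter set" where
  "remainder \<H> \<B> = {x. free_ultrafilter x \<and> \<H> \<subseteq> members x \<and> \<B> \<inter> members x = {}}"

text \<open>The injections from \<open>nat set\<close> demand at least continuum many elements,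
  since up to continuum many sets \<open>X\<close> compete for them in
  \<open>dense_labelling\<close>.\<close>

definition stage_family :: "nat set set \<Rightarrow> nat set set \<Rightarrow> bool" where
  "stage_family \<H> \<B> \<longleftrightarrow>
     (\<forall>B\<in>\<B>. infinite B \<and> (\<forall>A\<in>\<H>. B \<subset>\<^sup>* A)) \<and>
     (\<forall>B\<in>\<B>. \<forall>B'\<in>\<B>. B \<noteq> B' \<longrightarrow> finite (B \<inter> B')) \<and>
     (\<forall>x\<in>remainder \<H> \<B>. \<forall>X\<in>members x.
        (\<exists>g :: nat set \<Rightarrow> nat set. inj g \<and> range g \<subseteq> {B \<in> \<B>. B \<subseteq>\<^sup>* X}) \<and>
        (\<exists>g :: nat set \<Rightarrow> nat filter. inj g \<and> range g \<subseteq> {y \<in> remainder \<H> \<B>. X \<in> members y}))"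

lemma ex_bij_betw_infinite_nat:
  assumes "infinite (D :: nat set)" "infinite (E :: nat set)"
  shows "\<exists>f. bij_betw f D E"
  using bij_betw_trans[OF bij_betw_inv_into[OF bij_enumerate[OF assms(1)]] bij_enumerate[OF assms(2)]]
  by blast

context separable_mad
begin

section \<open>Preimages of the family under an injection\<close>

context
  fixes \<sigma> :: "nat \<Rightarrow> nat" and A\<^sub>0 :: "nat set"
  assumes inj: "inj_on \<sigma> A\<^sub>0"
begin

definition trace :: "nat set \<Rightarrow> nat set" where
  "trace a = A\<^sub>0 \<inter> \<sigma> -` a"

text \<open>The free ultrafilters containing \<open>A\<^sub>0\<close> whose image under
  \<open>\<sigma>\<close> contains no set of the ideal; that avoiding the members suffices is shown
  in \<open>rest_large\<close>.\<close>

definition rest :: "nat filter set" where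
  "rest = {x. free_ultrafilter x \<and> A\<^sub>0 \<in> members x \<and> (\<forall>a\<in>\<A>. trace a \<notin> members x)}"

lemma image_trace: "\<sigma> ` trace a = a \<inter> \<sigma> ` A\<^sub>0"
  by (auto simp: trace_def)

lemma finite_trace: "finite (\<sigma> ` A\<^sub>0 \<inter> a) \<Longrightarrow> finite (trace a)"
proof (rule finite_imageD)
  show "inj_on \<sigma> (trace a)" by (rule inj_on_subset[OF inj]) (auto simp: trace_def)
qed (simp add: image_trace Int_commute)

text \<open>The sets whose preimage is avoided by \<open>x\<close> obey the rules generating the
  ideal: finite sets by freeness and injectivity, unions because \<open>x\<close> is an
  ultrafilter.\<close>

lemma rest_large:
  assumes x: "x \<in> rest" and X: "X \<in> members x"
  shows "\<sigma> ` (X \<inter> A\<^sub>0) \<notin> small"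
proof
  have free: "free_ultrafilter x" and u: "ultrafilter x" and A0: "A\<^sub>0 \<in> members x"
    using x by (auto simp: rest_def free_ultrafilter_def)
  have none: "Z \<in> small \<Longrightarrow> trace Z \<notin> members x" for Z
  proof (induction rule: ideal_generated.induct)
    case (finite Z)
    then show ?case using free finite_trace[of Z] by (auto simp: free_ultrafilter_def)
  next
    case (member A)
    then show ?case using x by (simp add: rest_def)
  next
    case (union Y Z)
    have "trace (Y \<union> Z) = trace Y \<union> trace Z" by (auto simp: trace_def)
    then show ?case using union by (simp add: members_Un[OF u])
  next
    case (subset Y Z)
    then have "trace Z \<subseteq> trace Y" by (auto simp: trace_def)
    then show ?case using subset members_mono by blast
  qed
  assume "\<sigma> ` (X \<inter> A\<^sub>0) \<in> small"
  moreover have "X \<inter> A\<^sub>0 \<subseteq> trace (\<sigma> ` (X \<inter> A\<^sub>0))" by (auto simp: trace_def)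
  moreover have "X \<inter> A\<^sub>0 \<in> members x" using X A0 by (simp add: members_Int)
  ultimately show False using none members_mono by blast
qed

lemma rest_exists:
  assumes Y: "Y \<subseteq> \<sigma> ` A\<^sub>0" "Y \<notin> small"
  shows "\<exists>x\<in>rest. trace Y \<in> members x"
proof -
  let ?J = "{Z. \<sigma> ` (Z \<inter> A\<^sub>0) \<in> small}"
  have "\<sigma> ` (trace Y \<inter> A\<^sub>0) = Y" using Y(1) by (auto simp: trace_def)
  then have "trace Y \<notin> ?J" using Y(2) by simp
  then obtain x where x: "ultrafilter x" "trace Y \<in> members x" and avoid: "\<And>Z. Z \<in> ?J \<Longrightarrow> Z \<notin> members x"
  proof (rule ultrafilter_avoiding[of ?J "trace Y", rotated 3])
    fix Z Z' assume "Z \<in> ?J" "Z' \<in> ?J"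
    then show "Z \<union> Z' \<in> ?J" by (auto simp: Int_Un_distrib2 image_Un intro: ideal_generated.union)
  next
    fix Z Z' assume "Z \<in> ?J" "Z' \<subseteq> Z"
    then show "Z' \<in> ?J" by (auto intro: ideal_generated.subset)
  qed (auto intro: ideal_generated.finite)
  have "free_ultrafilter x"
    using x(1) avoid ideal_generated.finite by (auto simp: free_ultrafilter_def)
  moreover have "A\<^sub>0 \<in> members x" using x(2) members_mono by (auto simp: trace_def)
  moreover have "trace a \<notin> members x" if "a \<in> \<A>" for a
  proof (rule avoid)
    have "\<sigma> ` (trace a \<inter> A\<^sub>0) \<subseteq> a" by (auto simp: trace_def)
    then show "trace a \<in> ?J" using that ideal_generated.member ideal_generated.subset by blast
  qed
  ultimately show ?thesis using x(2) by (auto simp: rest_def)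
qed

lemma trace_image_subset: "Y \<subseteq> \<sigma> ` (X \<inter> A\<^sub>0) \<Longrightarrow> trace Y \<subseteq> X"
  using inj by (fastforce simp: trace_def inj_on_def)

text \<open>The image of \<open>X\<close> splits into continuum many sets outside the ideal. No
  ultrafilter in \<open>rest\<close> contains the preimages of two of them, as their intersection is
  in the ideal.\<close>

lemma rest_many:
  assumes x: "x \<in> rest" and X: "X \<in> members x"
  shows "\<exists>g :: nat set \<Rightarrow> nat filter. inj g \<and> range g \<subseteq> {y \<in> rest. X \<in> members y}"
proof -
  obtain Y :: "nat set \<Rightarrow> nat set" where Y: "\<And>s. Y s \<subseteq> \<sigma> ` (X \<inter> A\<^sub>0)" "\<And>s. Y s \<notin> small"
    "\<And>s t. s \<noteq> t \<Longrightarrow> Y s \<inter> Y t \<in> small"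
    using large_splits[OF rest_large[OF x X]] by metis
  have "\<exists>y\<in>rest. trace (Y s) \<in> members y" for s
    using Y(1,2) by (intro rest_exists) blast
  then obtain g where g: "\<And>s. g s \<in> rest" "\<And>s. trace (Y s) \<in> members (g s)" by metis
  have "inj g"
  proof (rule injI, rule ccontr)
    fix s t assume eq: "g s = g t" and "s \<noteq> t"
    have "trace (Y s) \<inter> trace (Y t) \<in> members (g s)" using g(2)[of s] g(2)[of t] eq by (simp add: members_Int)
    then have "\<sigma> ` (trace (Y s) \<inter> trace (Y t) \<inter> A\<^sub>0) \<notin> small" using g(1) rest_large by blast
    moreover have "\<sigma> ` (trace (Y s) \<inter> trace (Y t) \<inter> A\<^sub>0) \<subseteq> Y s \<inter> Y t" by (auto simp: trace_def)
    ultimately show False using Y(3)[OF \<open>s \<noteq> t\<close>] ideal_generated.subset by blast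
  qed
  moreover have "X \<in> members (g s)" for s
    using trace_image_subset[OF Y(1)] g(2) members_mono by blast
  ultimately show ?thesis using g(1) by blast
qed

text \<open>Each piece of the split image of \<open>X\<close> almost contains a member. Equal
  preimages for two pieces would force the two members to be equal, and then to lie almost in the
  intersection of the pieces.\<close>

lemma traces_many:
  assumes x: "x \<in> rest" and X: "X \<in> members x"
  shows "\<exists>g :: nat set \<Rightarrow> nat set. inj g \<and>
    range g \<subseteq> {trace a |a. a \<in> \<A> \<and> a \<subseteq>\<^sup>* \<sigma> ` A\<^sub>0 \<and> infinite (trace a) \<and> trace a \<subseteq>\<^sup>* X}"
proof -
  obtain Y :: "nat set \<Rightarrow> nat set" where Y: "\<And>s. Y s \<subseteq> \<sigma> ` (X \<inter> A\<^sub>0)" "\<And>s. Y s \<notin> small"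
    "\<And>s t A. s \<noteq> t \<Longrightarrow> A \<in> \<A> \<Longrightarrow> \<not> A \<subseteq>\<^sup>* Y s \<inter> Y t"
    using large_splits[OF rest_large[OF x X]] by metis
  have "\<exists>a\<in>\<A>. a \<subseteq>\<^sup>* Y s" for s using large_contains_member[OF Y(2)] by metis
  then obtain a where a: "\<And>s. a s \<in> \<A>" "\<And>s. a s \<subseteq>\<^sup>* Y s" by metis
  have aX: "a s \<subseteq>\<^sup>* \<sigma> ` (X \<inter> A\<^sub>0)" for s
    using a(2)[of s] Y(1)[of s] by (auto simp: almost_subset_def elim: finite_subset[rotated])
  then have a0: "a s \<subseteq>\<^sup>* \<sigma> ` A\<^sub>0" for s
    by (rule almost_subset_trans) (auto simp: almost_subset_def intro: finite_subset[of _ "{}"])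
  have inf: "infinite (a s \<inter> \<sigma> ` A\<^sub>0)" for s
  proof
    assume "finite (a s \<inter> \<sigma> ` A\<^sub>0)"
    then have "finite ((a s \<inter> \<sigma> ` A\<^sub>0) \<union> (a s - \<sigma> ` A\<^sub>0))" using a0 by (simp add: almost_subset_def)
    then show False using infinite_member[OF a(1)] by (simp add: Int_Diff_Un)
  qed
  have "trace (a s) - X \<subseteq> trace (a s - \<sigma> ` (X \<inter> A\<^sub>0))" for s
    using inj by (auto simp: trace_def inj_on_def)
  moreover have "finite (trace (a s - \<sigma> ` (X \<inter> A\<^sub>0)))" for s
    using aX by (intro finite_trace) (simp add: almost_subset_def)
  ultimately have tX: "trace (a s) \<subseteq>\<^sup>* X" for s unfolding almost_subset_def by (rule finite_subset)
  have tinf: "infinite (trace (a s))" for s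
    using inf image_trace finite_imageI by metis
  have "inj (\<lambda>s. trace (a s))"
  proof (rule injI, rule ccontr)
    fix s t assume "trace (a s) = trace (a t)" and st: "s \<noteq> t"
    then have "a s \<inter> \<sigma> ` A\<^sub>0 = a t \<inter> \<sigma> ` A\<^sub>0" using image_trace by metis
    then have "infinite (a s \<inter> a t)"
      using inf[of s] finite_subset[of "a s \<inter> \<sigma> ` A\<^sub>0" "a s \<inter> a t"] by blast
    then have "a s = a t" using finite_inter a(1) by blast
    then have "a s \<subseteq>\<^sup>* Y s \<inter> Y t" using a(2)[of s] a(2)[of t] by (simp add: almost_subset_def Diff_Int)
    then show False using Y(3)[OF st a(1)] by blast
  qed
  then show ?thesis using a(1) a0 tinf tX by (intro exI[of _ "\<lambda>s. trace (a s)"]) blast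
qed

text \<open>\<open>\<N>\<close> consists of the members used up in describing \<open>\<H>\<close>.
  The children promised by \<open>traces_many\<close> come from members almost inside the image of
  \<open>A\<^sub>0\<close>, so the second assumption keeps them out of \<open>\<N>\<close>.\<close>

lemma transported_stage_family:
  assumes N: "\<N> \<subseteq> \<A>" "\<And>a. a \<in> \<N> \<Longrightarrow> \<not> a \<subseteq>\<^sup>* \<sigma> ` A\<^sub>0"
    and H: "\<And>x. free_ultrafilter x \<Longrightarrow>
      \<H> \<subseteq> members x \<longleftrightarrow> A\<^sub>0 \<in> members x \<and> (\<forall>a\<in>\<N>. trace a \<notin> members x)"
    and below: "\<And>a A. a \<in> \<A> - \<N> \<Longrightarrow> A \<in> \<H> \<Longrightarrow> trace a \<subset>\<^sup>* A"
    and B_def: "\<B> = {trace a |a. a \<in> \<A> - \<N> \<and> infinite (trace a)}"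
  shows "stage_family \<H> \<B>" "remainder \<H> \<B> = rest"
proof -
  have "(\<forall>B\<in>\<B>. B \<notin> members x) \<longleftrightarrow> (\<forall>a\<in>\<A>-\<N>. trace a \<notin> members x)" if "free_ultrafilter x" for x
    using that by (auto simp: B_def free_ultrafilter_def)
  then show rem: "remainder \<H> \<B> = rest"
    using H N(1) unfolding remainder_def rest_def by blast
  have disj: "finite (B \<inter> B')" if BB: "B \<in> \<B>" "B' \<in> \<B>" "B \<noteq> B'" for B B'
  proof -
    obtain a a' where a: "B = trace a" "B' = trace a'" "a \<in> \<A>" "a' \<in> \<A>"
      using BB(1,2) unfolding B_def by blast
    then have "finite (a \<inter> a')" using finite_inter BB(3) by blast
    moreover have "B \<inter> B' = trace (a \<inter> a')" using a by (auto simp: trace_def)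
    ultimately show ?thesis by (simp add: finite_trace)
  qed
  have many: "\<exists>g :: nat set \<Rightarrow> nat set. inj g \<and> range g \<subseteq> {B \<in> \<B>. B \<subseteq>\<^sup>* X}"
    if "x \<in> rest" "X \<in> members x" for x X
  proof -
    have "{trace a |a. a \<in> \<A> \<and> a \<subseteq>\<^sup>* \<sigma> ` A\<^sub>0 \<and> infinite (trace a) \<and> trace a \<subseteq>\<^sup>* X} \<subseteq> {B \<in> \<B>. B \<subseteq>\<^sup>* X}"
      using N(2) by (auto simp: B_def)
    then show ?thesis using traces_many[OF that] by (meson order_trans)
  qed
  show "stage_family \<H> \<B>"
    unfolding stage_family_def rem using disj many rest_many below by (auto simp: B_def)
qed

end

section \<open>Stages with a least set and limit stages\<close>

lemma stage_family_min:
  assumes A: "A \<in> \<H>" "infinite A" and min: "\<And>A'. A' \<in> \<H> \<Longrightarrow> A = A' \<or> A \<subset>\<^sup>* A'"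
  obtains \<B> where "stage_family \<H> \<B>" "remainder \<H> \<B> \<noteq> {}"
proof -
  obtain \<sigma> :: "nat \<Rightarrow> nat" where "bij_betw \<sigma> A UNIV"
    using ex_bij_betw_infinite_nat[OF A(2), of UNIV] by auto
  then have inj: "inj_on \<sigma> A" and ran: "\<sigma> ` A = UNIV" by (auto simp: bij_betw_def)
  have minA: "A \<subseteq>\<^sup>* A'" if "A' \<in> \<H>" for A'
    using min[OF that] by (auto simp: almost_subset_def almost_psubset_def)
  have below: "trace \<sigma> A a \<subset>\<^sup>* A'" if a: "a \<in> \<A>" and A': "A' \<in> \<H>" for a A'
  proof (rule almost_psubset_trans1[OF _ minA[OF A']])
    \<comment> \<open>Beside a cofinite member every other member would be finite. The infinite
      complement makes the inclusion of the preimage in \<open>A\<close> strict.\<close>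
    have "infinite (- a)"
    proof
      assume "finite (- a)"
      then have co: "finite (a' - a)" for a' by (rule rev_finite_subset) auto
      have "\<A> \<subseteq> {a}"
      proof
        fix a' assume a': "a' \<in> \<A>"
        have "finite (a' \<inter> a)" if "a' \<noteq> a" using finite_inter[OF a' a that] .
        then show "a' \<in> {a}" using infinite_member[OF a'] co[of a'] by (metis Int_Diff_Un finite_UnI insertI1)
      qed
      then show False using infinite_family finite_subset by blast
    qed
    moreover have "\<sigma> ` (A - trace \<sigma> A a) = - a"
    proof
      show "- a \<subseteq> \<sigma> ` (A - trace \<sigma> A a)"
      proof
        fix n assume "n \<in> - a"
        moreover obtain k where "k \<in> A" "n = \<sigma> k" using ran by (metis UNIV_I imageE)
        ultimately show "n \<in> \<sigma> ` (A - trace \<sigma> A a)" by (auto simp: trace_def[OF inj])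
      qed
    qed (auto simp: trace_def[OF inj])
    ultimately have "infinite (A - trace \<sigma> A a)" using finite_imageI by metis
    moreover have "trace \<sigma> A a - A = {}" by (auto simp: trace_def[OF inj])
    ultimately show "trace \<sigma> A a \<subset>\<^sup>* A" by (metis almost_psubset_def finite.emptyI)
  qed
  define \<B> where "\<B> = {trace \<sigma> A a |a. a \<in> \<A> - {} \<and> infinite (trace \<sigma> A a)}"
  have H: "\<H> \<subseteq> members x \<longleftrightarrow> A \<in> members x \<and> (\<forall>a\<in>{}. trace \<sigma> A a \<notin> members x)"
    if "free_ultrafilter x" for x
    using members_almost_mono[OF that _ minA] A(1) by blast
  have sf: "stage_family \<H> \<B>" "remainder \<H> \<B> = rest \<sigma> A"
    using transported_stage_family[OF inj _ _ H _ \<B>_def] below by blast+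
  moreover have "rest \<sigma> A \<noteq> {}"
    using rest_exists[OF inj, of UNIV] UNIV_not_small ran by auto
  ultimately show ?thesis using that by metis
qed

text \<open>After changes by finite sets, the \<open>D n\<close> partition \<open>A' 0\<close>, and
  a free ultrafilter containing \<open>A' 0\<close> belongs to the stage iff it contains no
  \<open>D n\<close>. As \<open>\<sigma>\<close> carries \<open>D n\<close> into \<open>a n\<close>,
  this becomes avoidance of the preimages of the \<open>a n\<close>. Any other member meets each
  \<open>a n\<close> finitely, so its preimage meets each \<open>D n\<close> finitely and lies
  almost inside every \<open>A n\<close>.\<close>

lemma stage_family_limit:
  fixes A :: "nat \<Rightarrow> nat set"
  assumes A: "\<And>n. A n \<in> \<H>" "\<And>n. A (Suc n) \<subset>\<^sup>* A n" and cofinal: "\<And>C. C \<in> \<H> \<Longrightarrow> \<exists>n. A n \<subseteq>\<^sup>* C"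
  obtains \<B> where "stage_family \<H> \<B>"
proof -
  have le: "A n \<subseteq>\<^sup>* A i" if "i \<le> n" for i n
    using that
  proof (induction n rule: dec_induct)
    case base
    then show ?case by (simp add: almost_subset_def)
  next
    case (step n)
    then show ?case using A(2) almost_psubset_imp_subset almost_subset_trans by blast
  qed
  \<comment> \<open>Removing \<open>{..<n}\<close> empties the intersection of the sequence, so that
    every element of \<open>A' 0\<close> falls into some difference.\<close>
  define A' where "A' n = (\<Inter>i\<le>n. A i) - {..<n}" for n
  have dec: "A' n \<subseteq> A' i" if "i \<le> n" for i n using that by (auto simp: A'_def)
  have A'A: "A' n \<subseteq> A n" for n by (auto simp: A'_def)
  have AA': "A n \<subseteq>\<^sup>* A' n" for n
  proof -
    have "finite ((\<Union>i\<le>n. A n - A i) \<union> {..<n})"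
      using le unfolding almost_subset_def by (intro finite_UnI finite_UN_I) auto
    moreover have "A n - A' n \<subseteq> (\<Union>i\<le>n. A n - A i) \<union> {..<n}" by (auto simp: A'_def)
    ultimately show ?thesis unfolding almost_subset_def by (rule finite_subset[rotated])
  qed
  define D where "D n = A' n - A' (Suc n)" for n
  have Dinf: "infinite (D n)" for n
  proof
    assume "finite (D n)"
    moreover have "A n - A (Suc n) \<subseteq> D n \<union> (A n - A' n)" using A'A[of "Suc n"] by (auto simp: D_def)
    ultimately have "finite (A n - A (Suc n))" using AA'[of n] unfolding almost_subset_def
      by (meson finite_UnI finite_subset)
    then show False using A(2)[of n] by (simp add: almost_psubset_def)
  qed
  define idx where "idx k = (LEAST n. k \<notin> A' (Suc n))" for k
  have idx: "k \<in> D (idx k)" if "k \<in> A' 0" for k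
  proof -
    have "k \<notin> A' (Suc k)" by (simp add: A'_def)
    then have "k \<notin> A' (Suc (idx k))" unfolding idx_def by (rule LeastI)
    moreover have "k \<in> A' (idx k)"
    proof (cases "idx k")
      case (Suc m)
      then have "k \<in> A' (Suc m)"
        using not_less_Least[of m "\<lambda>n. k \<notin> A' (Suc n)"] unfolding idx_def by simp
      then show ?thesis unfolding Suc .
    qed (use that in simp)
    ultimately show ?thesis by (simp add: D_def)
  qed
  have idx_eq: "idx k = n" if "k \<in> D n" for k n
  proof -
    have k: "k \<in> D (idx k)" using that dec[of 0 n] by (intro idx) (auto simp: D_def)
    have "\<not> n < idx k" using k that dec[of "Suc n" "idx k"] by (auto simp: D_def)
    moreover have "\<not> idx k < n" using k that dec[of "Suc (idx k)" n] by (auto simp: D_def)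
    ultimately show ?thesis by simp
  qed
  obtain a :: "nat \<Rightarrow> nat set" where "inj a" "range a \<subseteq> \<A>"
    using infinite_countable_subset[OF infinite_family] by blast
  then have a: "inj a" "\<And>i. a i \<in> \<A>" by auto
  define b where "b i = a i - (\<Union>j<i. a j)" for i
  have ba: "b i \<inter> a j = {}" if "j < i" for i j using that by (auto simp: b_def)
  have bdisj: "b i \<inter> b j = {}" if "i \<noteq> j" for i j
    using that by (cases "i < j") (auto simp: b_def)
  \<comment> \<open>The omitted half of \<open>b i\<close> keeps \<open>a i\<close> out of the members almost contained in \<open>\<sigma> ` A' 0\<close>,
    among which the children are found.\<close>
  have "\<exists>E. E \<subseteq> b i \<and> infinite E \<and> infinite (b i - E)" for i
    by (rule infinite_halves[OF infinite_disjointed[OF a, of i]]) (unfold b_def, blast)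
  then obtain E where E: "\<And>i. E i \<subseteq> b i" "\<And>i. infinite (E i)" "\<And>i. infinite (b i - E i)" by metis
  have Ea: "E i \<subseteq> a i" for i using E(1) by (auto simp: b_def)
  have "\<exists>\<tau>. bij_betw \<tau> (D n) (E n)" for n using ex_bij_betw_infinite_nat Dinf E(2) by blast
  then obtain \<tau> where \<tau>: "\<And>n. bij_betw (\<tau> n) (D n) (E n)" by metis
  define \<sigma> where "\<sigma> k = \<tau> (idx k) k" for k
  have \<sigma>E: "\<sigma> k \<in> E (idx k)" if "k \<in> A' 0" for k
    using \<tau> idx[OF that] unfolding \<sigma>_def bij_betw_def by blast
  have inj: "inj_on \<sigma> (A' 0)"
  proof (rule inj_onI)
    fix k l assume k: "k \<in> A' 0" and l: "l \<in> A' 0" and eq: "\<sigma> k = \<sigma> l"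
    have "idx k = idx l" 
      using \<sigma>E[OF k] \<sigma>E[OF l] eq E(1)[of "idx k"] E(1)[of "idx l"] bdisj[of "idx k" "idx l"] by auto
    then show "k = l" using eq idx[OF k] idx[OF l] \<tau>[of "idx l"]
      by (simp add: \<sigma>_def bij_betw_def inj_on_def)
  qed
  note tr = trace_def[OF inj]
  have N: "\<not> a n \<subseteq>\<^sup>* \<sigma> ` A' 0" for n
  proof
    assume "a n \<subseteq>\<^sup>* \<sigma> ` A' 0"
    moreover have "b n - E n \<subseteq> a n - \<sigma> ` A' 0"
    proof
      fix k assume k: "k \<in> b n - E n"
      have "k \<notin> E j" for j using k E(1)[of j] bdisj[of n j] by (cases "j = n") auto
      then show "k \<in> a n - \<sigma> ` A' 0" using k \<sigma>E by (auto simp: b_def)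
    qed
    ultimately show False using E(3) finite_subset unfolding almost_subset_def by blast
  qed
  have tr_disj: "trace \<sigma> (A' 0) (a n) \<inter> A' (Suc n) = {}" for n
  proof (rule ccontr)
    assume "\<not> ?thesis"
    then obtain k where k: "k \<in> A' 0" "\<sigma> k \<in> a n" "k \<in> A' (Suc n)" by (auto simp: tr)
    \<comment> \<open>Membership in \<open>A' (Suc n)\<close> puts \<open>k\<close> in a later
      piece, whose image lies in a \<open>b i\<close> from which \<open>a n\<close> has been
      removed.\<close>
    have "n < idx k"
    proof (rule ccontr)
      assume "\<not> n < idx k"
      then have "A' (Suc n) \<subseteq> A' (Suc (idx k))" by (intro dec) simp
      then show False using idx[OF k(1)] k(3) by (auto simp: D_def)
    qed
    then show False using ba[of n "idx k"] \<sigma>E[OF k(1)] k(2) E(1)[of "idx k"] by blast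
  qed
  have Dtr: "D n \<subseteq> trace \<sigma> (A' 0) (a n)" for n
  proof
    fix k assume k: "k \<in> D n"
    then have "k \<in> A' 0" using dec[of 0 n] by (auto simp: D_def)
    then show "k \<in> trace \<sigma> (A' 0) (a n)" using \<sigma>E[of k] Ea idx_eq[OF k] by (auto simp: tr)
  qed
  have H: "\<H> \<subseteq> members x \<longleftrightarrow>
      A' 0 \<in> members x \<and> (\<forall>c\<in>range a. trace \<sigma> (A' 0) c \<notin> members x)" if x: "free_ultrafilter x" for x
  proof
    assume Hx: "\<H> \<subseteq> members x"
    have A'x: "A' n \<in> members x" for n using members_almost_mono[OF x _ AA'] Hx A(1) by blast
    moreover have "trace \<sigma> (A' 0) (a n) \<notin> members x" for n
      using members_finite_Int[OF x A'x[of "Suc n"], of "trace \<sigma> (A' 0) (a n)"] tr_disj[of n]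
      by (simp add: Int_commute)
    ultimately show "A' 0 \<in> members x \<and> (\<forall>c\<in>range a. trace \<sigma> (A' 0) c \<notin> members x)" by blast
  next
    assume R: "A' 0 \<in> members x \<and> (\<forall>c\<in>range a. trace \<sigma> (A' 0) c \<notin> members x)"
    have A'x: "A' n \<in> members x" for n
    proof (induction n)
      case (Suc n)
      then have "A' n - trace \<sigma> (A' 0) (a n) \<in> members x"
        using R x by (simp add: members_Diff free_ultrafilter_def)
      then show ?case by (rule members_mono) (use Dtr[of n] in \<open>auto simp: D_def\<close>)
    qed (use R in simp)
    show "\<H> \<subseteq> members x"
    proof
      fix C assume "C \<in> \<H>"
      then obtain n where "A n \<subseteq>\<^sup>* C" using cofinal by blast
      then show "C \<in> members x"
        using members_almost_mono[OF x members_mono[OF A'x A'A]] by blast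
    qed
  qed
  have Dfin: "finite (D n \<inter> trace \<sigma> (A' 0) c)" if c: "c \<in> \<A> - range a" for c n
  proof -
    have "finite (a n \<inter> c)" using finite_inter[OF a(2)] c by blast
    then have "finite (trace \<sigma> (A' 0) (a n \<inter> c))" by (intro finite_trace[OF inj]) simp
    then show ?thesis by (rule rev_finite_subset) (use Dtr[of n] in \<open>auto simp: tr\<close>)
  qed
  have below: "trace \<sigma> (A' 0) c \<subset>\<^sup>* C" if c: "c \<in> \<A> - range a" and "C \<in> \<H>" for c C
  proof -
    obtain n where n: "A n \<subseteq>\<^sup>* C" using cofinal \<open>C \<in> \<H>\<close> by blast
    have "trace \<sigma> (A' 0) c - A n \<subseteq> (\<Union>i<n. D i \<inter> trace \<sigma> (A' 0) c)"
    proof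
      fix k assume k: "k \<in> trace \<sigma> (A' 0) c - A n"
      then have k0: "k \<in> A' 0" by (simp add: tr)
      have "\<not> n \<le> idx k" using k A'A[of n] dec[of n "idx k"] idx[OF k0] by (auto simp: D_def)
      then show "k \<in> (\<Union>i<n. D i \<inter> trace \<sigma> (A' 0) c)" using idx[OF k0] k by auto
    qed
    then have fin: "finite (trace \<sigma> (A' 0) c - A n)"
      by (rule finite_subset) (use Dfin[OF c] in blast)
    have "infinite (A n - trace \<sigma> (A' 0) c)"
    proof
      assume "finite (A n - trace \<sigma> (A' 0) c)"
      moreover have "D n \<subseteq> (A n - trace \<sigma> (A' 0) c) \<union> (D n \<inter> trace \<sigma> (A' 0) c)"
        using A'A[of n] by (auto simp: D_def)
      ultimately show False using Dinf Dfin[OF c] by (meson finite_UnI finite_subset)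
    qed
    with fin have "trace \<sigma> (A' 0) c \<subset>\<^sup>* A n" by (simp add: almost_psubset_def)
    then show ?thesis using n almost_psubset_trans1 by blast
  qed
  have "stage_family \<H> {trace \<sigma> (A' 0) c |c. c \<in> \<A> - range a \<and> infinite (trace \<sigma> (A' 0) c)}"
    using a(2) N by (intro transported_stage_family(1)[OF inj _ _ H below refl]) auto
  then show ?thesis using that by blast
qed

end

section \<open>Maximal consistent sets\<close>

instance fm :: countable
  by countable_datatype

lemma ultrafilter_imp:
  assumes "ultrafilter U"
  shows "(\<forall>\<^sub>F x in U. P x \<longrightarrow> Q x) \<longleftrightarrow> ((\<forall>\<^sub>F x in U. P x) \<longrightarrow> (\<forall>\<^sub>F x in U. Q x))"
proof
  assume "(\<forall>\<^sub>F x in U. P x) \<longrightarrow> (\<forall>\<^sub>F x in U. Q x)"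
  then have "(\<forall>\<^sub>F x in U. \<not> P x) \<or> (\<forall>\<^sub>F x in U. Q x)"
    using ultrafilter_not[OF assms, of P] by blast
  then show "\<forall>\<^sub>F x in U. P x \<longrightarrow> Q x" by (auto elim: eventually_mono)
qed (auto elim: eventually_elim2)

lemma bool_eval_foldr_Imp:
  "bool_eval g h (foldr Imp \<eta>s \<psi>) \<longleftrightarrow> ((\<forall>\<eta>\<in>set \<eta>s. bool_eval g h \<eta>) \<longrightarrow> bool_eval g h \<psi>)"
  by (induction \<eta>s) auto

locale s412_theory =
  fixes \<Gamma> :: "fm set"
begin

abbreviation provable :: "fm \<Rightarrow> bool" where
  "provable \<equiv> derivable S412_axioms \<Gamma>"

text \<open>Maximal consistent sets: the clause for implication makes membership a Boolean
  valuation, which covers maximality and closure under modus ponens.\<close>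

definition world :: "fm set \<Rightarrow> bool" where
  "world w \<longleftrightarrow> (\<forall>\<phi>. provable \<phi> \<longrightarrow> \<phi> \<in> w) \<and> \<^bold>\<bottom> \<notin> w \<and>
     (\<forall>\<phi> \<psi>. \<phi> \<^bold>\<longrightarrow> \<psi> \<in> w \<longleftrightarrow> (\<phi> \<in> w \<longrightarrow> \<psi> \<in> w))"

text \<open>The canonical accessibility relation is \<open>boxed w \<subseteq> v\<close>; worlds
  with equal \<open>boxed\<close> sets form a cluster.\<close>

definition boxed :: "fm set \<Rightarrow> fm set" where
  "boxed w = {\<phi>. \<box> \<phi> \<in> w}"

lemma provable_tautology: "tautology \<phi> \<Longrightarrow> provable \<phi>"
  by (rule derivable.axiom) (simp add: S412_axioms_def S4_axioms_def)

lemma provable_K: "provable (\<box> (\<phi> \<^bold>\<longrightarrow> \<psi>) \<^bold>\<longrightarrow> (\<box> \<phi> \<^bold>\<longrightarrow> \<box> \<psi>))"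
  by (rule derivable.axiom) (auto simp: S412_axioms_def S4_axioms_def)

lemma provable_T: "provable (\<box> \<phi> \<^bold>\<longrightarrow> \<phi>)"
  by (rule derivable.axiom) (auto simp: S412_axioms_def S4_axioms_def)

lemma provable_4: "provable (\<box> \<phi> \<^bold>\<longrightarrow> \<box> \<box> \<phi>)"
  by (rule derivable.axiom) (auto simp: S412_axioms_def S4_axioms_def)

lemma provable_12: "provable (\<box> \<diamond> \<phi> \<^bold>\<longleftrightarrow> \<diamond> \<box> \<phi>)"
  by (rule derivable.axiom) (auto simp: S412_axioms_def)

lemma provable_foldr_mp:
  "provable (foldr Imp \<eta>s \<psi>) \<Longrightarrow> (\<And>\<eta>. \<eta> \<in> set \<eta>s \<Longrightarrow> provable \<eta>) \<Longrightarrow> provable \<psi>"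
  by (induction \<eta>s) (auto intro: derivable.mp)

lemma world_provable: "world w \<Longrightarrow> provable \<phi> \<Longrightarrow> \<phi> \<in> w"
  by (simp add: world_def)

lemma world_Fls: "world w \<Longrightarrow> \<^bold>\<bottom> \<notin> w"
  by (simp add: world_def)

lemma world_Imp: "world w \<Longrightarrow> \<phi> \<^bold>\<longrightarrow> \<psi> \<in> w \<longleftrightarrow> (\<phi> \<in> w \<longrightarrow> \<psi> \<in> w)"
  by (simp add: world_def)

lemmas world_simps = world_Fls world_Imp

lemma world_maximal: "world v \<Longrightarrow> world w \<Longrightarrow> v \<subseteq> w \<Longrightarrow> v = w"
proof (rule ccontr)
  assume vw: "world v" "world w" "v \<subseteq> w" "v \<noteq> w"
  then obtain \<phi> where "\<phi> \<in> w" "\<phi> \<notin> v" by blast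
  then have "\<^bold>\<not> \<phi> \<in> w" using vw world_simps by blast
  then show False using vw world_simps \<open>\<phi> \<in> w\<close> by blast
qed

text \<open>A compactness argument over Boolean evaluations: finite parts of \<open>\<Delta>\<close>
  are satisfiable, since otherwise a tautology would prove one of the excluded implications, and
  \<open>w\<close> collects what holds almost everywhere for an ultrafilter on evaluations.\<close>

lemma world_extension:
  assumes unprovable: "\<And>\<eta>s. set \<eta>s \<subseteq> \<Sigma> \<Longrightarrow> \<not> provable (foldr Imp \<eta>s \<psi>)"
  obtains w where "world w" "\<Sigma> \<subseteq> w" "\<psi> \<notin> w"
proof -
  define sat where "sat e \<phi> = bool_eval (fst e) (snd e) \<phi>" for e \<phi>
  define \<Delta> where "\<Delta> = insert (\<^bold>\<not> \<psi>) ({\<phi>. provable \<phi>} \<union> \<Sigma>)"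
  define F where "F = (INF \<phi>\<in>\<Delta>. principal {e. sat e \<phi>})"
  have "F \<noteq> bot"
  proof
    assume "F = bot"
    then have "eventually (\<lambda>_. False) (INF \<phi>\<in>\<Delta>. principal {e. sat e \<phi>})" by (simp add: F_def)
    then obtain C where C: "C \<subseteq> \<Delta>" "finite C" and ev: "eventually (\<lambda>_. False) (INF \<phi>\<in>C. principal {e. sat e \<phi>})"
      unfolding eventually_INF[of _ _ \<Delta>] by (elim exE conjE)
    have INF_C: "(INF \<phi>\<in>C. principal {e. sat e \<phi>}) = principal (\<Inter>\<phi>\<in>C. {e. sat e \<phi>})"
      using C(2) by (rule INF_principal_finite)
    then have unsat: "\<exists>\<phi>\<in>C. \<not> sat e \<phi>" for e
      using ev unfolding INF_C eventually_principal by blast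
    obtain ps where ps: "set ps = {\<phi> \<in> C. provable \<phi>}" using C(2) finite_list[of "{\<phi> \<in> C. provable \<phi>}"] by auto
    obtain ss where ss: "set ss = C \<inter> \<Sigma>" using C(2) finite_list[of "C \<inter> \<Sigma>"] by auto
    have "tautology (foldr Imp ps (foldr Imp ss \<psi>))"
      unfolding tautology_def bool_eval_foldr_Imp
    proof (intro allI impI)
      fix g h
      assume *: "\<forall>\<eta>\<in>set ps. bool_eval g h \<eta>" "\<forall>\<eta>\<in>set ss. bool_eval g h \<eta>"
      obtain \<phi> where "\<phi> \<in> C" "\<not> bool_eval g h \<phi>" using unsat[of "(g, h)"] by (auto simp: sat_def)
      moreover from this have "\<phi> = \<^bold>\<not> \<psi>" using * C(1) ps ss by (auto simp: \<Delta>_def)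
      ultimately show "bool_eval g h \<psi>" by simp
    qed
    then have "provable (foldr Imp ss \<psi>)" using provable_foldr_mp provable_tautology ps by blast
    then show False using unprovable ss by blast
  qed
  then obtain U where U: "ultrafilter U" "U \<le> F" using ultrafilter_exists by blast
  define w where "w = {\<phi>. \<forall>\<^sub>F e in U. sat e \<phi>}"
  have \<Delta>w: "\<Delta> \<subseteq> w"
  proof
    fix \<phi> assume "\<phi> \<in> \<Delta>"
    then have "F \<le> principal {e. sat e \<phi>}" by (auto simp: F_def intro: INF_lower)
    then have "U \<le> principal {e. sat e \<phi>}" using U(2) by (rule order_trans[rotated])
    then show "\<phi> \<in> w" by (simp add: w_def le_principal)
  qed
  have "world w"
    unfolding world_def
  proof (intro conjI allI impI)
    show "\<^bold>\<bottom> \<notin> w" using U(1) by (simp add: w_def sat_def ultrafilter_def)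
    show "\<phi> \<^bold>\<longrightarrow> \<psi> \<in> w \<longleftrightarrow> (\<phi> \<in> w \<longrightarrow> \<psi> \<in> w)" for \<phi> \<psi>
      using ultrafilter_imp[OF U(1)] by (simp add: w_def sat_def)
  qed (use \<Delta>w in \<open>auto simp: \<Delta>_def\<close>)
  moreover have "\<psi> \<notin> w" using \<Delta>w calculation world_simps by (auto simp: \<Delta>_def)
  ultimately show ?thesis using that \<Delta>w by (auto simp: \<Delta>_def)
qed

lemma world_refuting:
  assumes "\<not> provable \<phi>"
  obtains w where "world w" "\<phi> \<notin> w"
  using world_extension[of "{}" \<phi>] assms by auto

lemma boxed_subset: "world w \<Longrightarrow> boxed w \<subseteq> w"
  using world_provable[OF _ provable_T] by (auto simp: boxed_def world_simps)

lemma boxed_Box: "world w \<Longrightarrow> \<phi> \<in> boxed w \<Longrightarrow> \<box> \<phi> \<in> boxed w"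
  using world_provable[OF _ provable_4] by (auto simp: boxed_def world_simps)

lemma boxed_mono: "world w \<Longrightarrow> boxed w \<subseteq> v \<Longrightarrow> boxed w \<subseteq> boxed v"
  using boxed_Box by (auto simp: boxed_def)

lemma boxed_mp: "world w \<Longrightarrow> \<phi> \<^bold>\<longrightarrow> \<psi> \<in> boxed w \<Longrightarrow> \<phi> \<in> boxed w \<Longrightarrow> \<psi> \<in> boxed w"
  using world_provable[OF _ provable_K] by (auto simp: boxed_def world_simps)

lemma provable_boxed: "world w \<Longrightarrow> provable \<phi> \<Longrightarrow> \<phi> \<in> boxed w"
  using world_provable derivable.nec by (auto simp: boxed_def)

text \<open>A provable implication from finitely many formulas of \<open>boxed w\<close> could be
  boxed by necessitation and detached inside \<open>boxed w\<close> by K.\<close>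

lemma world_successor:
  assumes w: "world w" and \<psi>: "\<psi> \<notin> boxed w"
  obtains v where "world v" "boxed w \<subseteq> v" "\<psi> \<notin> v"
proof (rule world_extension[of "boxed w" \<psi>])
  fix \<eta>s assume \<eta>s: "set \<eta>s \<subseteq> boxed w"
  show "\<not> provable (foldr Imp \<eta>s \<psi>)"
  proof
    assume "provable (foldr Imp \<eta>s \<psi>)"
    then have "foldr Imp \<eta>s \<psi> \<in> boxed w" using w provable_boxed by blast
    then have "\<psi> \<in> boxed w" using \<eta>s by (induction \<eta>s) (auto dest: boxed_mp[OF w])
    then show False using \<psi> by blast
  qed
qed (use that in blast)

lemma world_Box: "world w \<Longrightarrow> \<box> \<phi> \<in> w \<longleftrightarrow> (\<forall>v. world v \<longrightarrow> boxed w \<subseteq> v \<longrightarrow> \<phi> \<in> v)"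
proof
  assume w: "world w" and all: "\<forall>v. world v \<longrightarrow> boxed w \<subseteq> v \<longrightarrow> \<phi> \<in> v"
  show "\<box> \<phi> \<in> w"
  proof (rule ccontr)
    assume "\<box> \<phi> \<notin> w"
    then have "\<phi> \<notin> boxed w" by (simp add: boxed_def)
    then obtain v where "world v" "boxed w \<subseteq> v" "\<phi> \<notin> v" by (rule world_successor[OF w])
    then show False using all by blast
  qed
qed (auto simp: boxed_def)

lemma world_Dia: "world w \<Longrightarrow> \<diamond> \<phi> \<in> w \<longleftrightarrow> (\<exists>v. world v \<and> boxed w \<subseteq> v \<and> \<phi> \<in> v)"
  using world_simps by (auto simp: world_Box)

lemma world_12: "world w \<Longrightarrow> \<box> \<diamond> \<phi> \<in> w \<longleftrightarrow> \<diamond> \<box> \<phi> \<in> w"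
  using world_provable[OF _ provable_12[of \<phi>]] by (simp add: world_Imp world_Fls) blast

text \<open>This supplies the cluster at a limit stage. The worlds behind the chain need not be
  comparable themselves, so \<open>w\<close> is their limit along an ultrafilter concentrating on
  later members of \<open>M\<close>.\<close>

lemma limit_world:
  assumes M: "M \<noteq> {}" "\<And>S T. S \<in> M \<Longrightarrow> T \<in> M \<Longrightarrow> S \<subseteq> T \<or> T \<subseteq> S"
    and wM: "\<And>T. T \<in> M \<Longrightarrow> \<exists>w. world w \<and> boxed w = T"
  obtains w where "world w" "boxed w = \<Union>M"
proof -
  \<comment> \<open>Requiring \<open>boxed w \<in> M\<close> keeps the boxed part of the limit
    inside the union.\<close>
  define W where "W T = {w. world w \<and> T \<subseteq> boxed w \<and> boxed w \<in> M}" for T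
  define F where "F = (INF T\<in>M. principal (W T))"
  have ev: "eventually P F \<longleftrightarrow> (\<exists>T\<in>M. eventually P (principal (W T)))" for P
    unfolding F_def
  proof (rule eventually_INF_base)
    fix S T assume "S \<in> M" "T \<in> M"
    then have "S \<union> T \<in> M" using M(2)[of S T] by (auto simp: sup.absorb1 sup.absorb2)
    then show "\<exists>x\<in>M. principal (W x) \<le> inf (principal (W S)) (principal (W T))"
      by (intro bexI[of _ "S \<union> T"]) (auto simp: W_def)
  qed (use M in auto)
  have "W T \<noteq> {}" if "T \<in> M" for T using wM[OF that] that by (auto simp: W_def)
  then have "F \<noteq> bot" using ev[of "\<lambda>_. False"] by (auto simp: eventually_principal trivial_limit_def)
  then obtain U where U: "ultrafilter U" "U \<le> F" using ultrafilter_exists by blast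
  have WU: "\<forall>\<^sub>F v in U. v \<in> W T" if "T \<in> M" for T
    using ev[of "\<lambda>v. v \<in> W T"] that U(2) by (auto simp: le_filter_def eventually_principal)
  obtain T\<^sub>0 where "T\<^sub>0 \<in> M" using M(1) by blast
  then have ww: "\<forall>\<^sub>F v in U. world v" and wM': "\<forall>\<^sub>F v in U. boxed v \<in> M"
    using WU[of T\<^sub>0] by (auto simp: W_def elim: eventually_mono)
  define w where "w = {\<phi>. \<forall>\<^sub>F v in U. \<phi> \<in> v}"
  have "world w"
    unfolding world_def
  proof (intro conjI allI impI)
    show "\<phi> \<in> w" if "provable \<phi>" for \<phi>
      using ww unfolding w_def by (auto elim!: eventually_mono intro: world_provable that)
    have "\<forall>\<^sub>F v in U. \<^bold>\<bottom> \<notin> v" using ww by (auto elim!: eventually_mono dest: world_Fls)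
    then show "\<^bold>\<bottom> \<notin> w" using ultrafilter_not[OF U(1), of "\<lambda>v. \<^bold>\<bottom> \<in> v"] by (simp add: w_def)
    show "\<phi> \<^bold>\<longrightarrow> \<psi> \<in> w \<longleftrightarrow> (\<phi> \<in> w \<longrightarrow> \<psi> \<in> w)" for \<phi> \<psi>
    proof -
      have "(\<forall>\<^sub>F v in U. \<phi> \<^bold>\<longrightarrow> \<psi> \<in> v) \<longleftrightarrow> (\<forall>\<^sub>F v in U. \<phi> \<in> v \<longrightarrow> \<psi> \<in> v)"
        by (rule eventually_cong[OF ww]) (simp add: world_Imp)
      then show ?thesis using ultrafilter_imp[OF U(1)] by (simp add: w_def)
    qed
  qed
  moreover have "boxed w = \<Union>M"
  proof (intro equalityI subsetI)
    fix \<phi> assume "\<phi> \<in> boxed w"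
    then have "\<forall>\<^sub>F v in U. \<phi> \<in> boxed v" by (simp add: boxed_def w_def)
    then have "\<forall>\<^sub>F v in U. \<phi> \<in> \<Union>M" using wM' by eventually_elim blast
    then show "\<phi> \<in> \<Union>M" using U(1) by (auto simp: ultrafilter_def)
  next
    fix \<phi> assume "\<phi> \<in> \<Union>M"
    then obtain T where "T \<in> M" "\<phi> \<in> T" by blast
    then have "\<forall>\<^sub>F v in U. \<box> \<phi> \<in> v" using WU[of T] by (auto simp: W_def boxed_def elim!: eventually_mono)
    then show "\<phi> \<in> boxed w" by (simp add: boxed_def w_def)
  qed
  ultimately show ?thesis using that by blast
qed

section \<open>The final world above a given world\<close>

definition top_world :: "fm set \<Rightarrow> fm set" where
  "top_world w = {\<phi>. \<diamond> \<box> \<phi> \<in> w}"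

lemma world_Box_mono: "world u \<Longrightarrow> world v \<Longrightarrow> boxed u \<subseteq> v \<Longrightarrow> \<box> \<phi> \<in> u \<Longrightarrow> \<box> \<phi> \<in> v"
  using boxed_mono[of u v] by (auto simp: boxed_def)

lemma world_trans: "world u \<Longrightarrow> boxed u \<subseteq> v \<Longrightarrow> boxed v \<subseteq> x \<Longrightarrow> boxed u \<subseteq> x"
  using boxed_mono by blast

text \<open>The two directions of the axiom have separate roles. From box-diamond to diamond-box it
  decides every formula; the converse makes a formula boxed at one successor boxed somewhere above
  every successor, so that two such formulas can be combined.\<close>

lemma top_world_world:
  assumes w: "world w"
  shows "world (top_world w)"
  unfolding world_def
proof (intro conjI allI impI)
  have mem: "\<phi> \<in> top_world w \<longleftrightarrow> (\<exists>v. world v \<and> boxed w \<subseteq> v \<and> \<box> \<phi> \<in> v)" for \<phi>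
    by (simp add: top_world_def world_Dia[OF w])
  then have memI: "world v \<Longrightarrow> boxed w \<subseteq> v \<Longrightarrow> \<box> \<phi> \<in> v \<Longrightarrow> \<phi> \<in> top_world w" for v \<phi> by blast
  have cofinal: "\<exists>u. world u \<and> boxed v \<subseteq> u \<and> \<box> \<phi> \<in> u"
    if "\<phi> \<in> top_world w" "world v" "boxed w \<subseteq> v" for \<phi> v
  proof -
    \<comment> \<open>The axiom is needed for \<open>\<box> \<phi>\<close> in place of
      \<open>\<phi>\<close>, hence the detour through transitivity.\<close>
    have "\<box> \<phi> \<in> top_world w" using that(1) world_provable[OF _ provable_4] unfolding mem by (metis world_Imp)
    then have "\<box> \<diamond> \<box> \<phi> \<in> w" using world_12[OF w] by (simp add: top_world_def)
    then show ?thesis using that(2,3) world_Box[OF w] world_Dia by blast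
  qed
  show "\<phi> \<in> top_world w" if "provable \<phi>" for \<phi>
    using world_provable[OF w derivable.nec[OF that]] w boxed_subset memI by blast
  show "\<^bold>\<bottom> \<notin> top_world w"
    using boxed_subset world_Fls unfolding mem boxed_def by blast
  have neg: "\<phi> \<notin> top_world w \<Longrightarrow> \<^bold>\<not> \<phi> \<in> top_world w" for \<phi>
  proof -
    assume "\<phi> \<notin> top_world w"
    then have "\<diamond> \<box> \<phi> \<notin> w" by (simp add: top_world_def)
    then have "\<box> \<diamond> \<phi> \<notin> w" using world_12[OF w] by blast
    then obtain v where v: "world v" "boxed w \<subseteq> v" "\<diamond> \<phi> \<notin> v" using world_Box[OF w] by blast
    then have "\<box> \<^bold>\<not> \<phi> \<in> v" using world_simps by blast
    then show "\<^bold>\<not> \<phi> \<in> top_world w" using v memI by blast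
  qed
  have top_Imp: "\<phi> \<^bold>\<longrightarrow> \<psi> \<in> top_world w"
    if \<eta>: "\<eta> \<in> top_world w" and taut: "tautology (\<eta> \<^bold>\<longrightarrow> (\<phi> \<^bold>\<longrightarrow> \<psi>))" for \<eta> \<phi> \<psi>
  proof -
    obtain v where v: "world v" "boxed w \<subseteq> v" "\<box> \<eta> \<in> v" using \<eta>[unfolded mem] by blast
    have "\<eta> \<^bold>\<longrightarrow> (\<phi> \<^bold>\<longrightarrow> \<psi>) \<in> boxed v" using provable_boxed[OF v(1) provable_tautology[OF taut]] .
    then have "\<phi> \<^bold>\<longrightarrow> \<psi> \<in> boxed v" using boxed_mp[OF v(1)] v(3) by (auto simp: boxed_def)
    then show ?thesis using v by (intro memI) (auto simp: boxed_def)
  qed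
  fix \<phi> \<psi>
  show "\<phi> \<^bold>\<longrightarrow> \<psi> \<in> top_world w \<longleftrightarrow> (\<phi> \<in> top_world w \<longrightarrow> \<psi> \<in> top_world w)"
  proof
    assume imp: "\<phi> \<^bold>\<longrightarrow> \<psi> \<in> top_world w"
    show "\<phi> \<in> top_world w \<longrightarrow> \<psi> \<in> top_world w"
    proof
      assume \<phi>: "\<phi> \<in> top_world w"
      obtain v where v: "world v" "boxed w \<subseteq> v" "\<box> (\<phi> \<^bold>\<longrightarrow> \<psi>) \<in> v" using imp[unfolded mem] by blast
      obtain u where u: "world u" "boxed v \<subseteq> u" "\<box> \<phi> \<in> u" using cofinal[OF \<phi> v(1,2)] by blast
      have "\<box> (\<phi> \<^bold>\<longrightarrow> \<psi>) \<in> u" using world_Box_mono[OF v(1) u(1,2) v(3)] .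
      then have "\<psi> \<in> boxed u" using boxed_mp[OF u(1), of \<phi> \<psi>] u(3) by (simp add: boxed_def)
      then have "\<box> \<psi> \<in> u" by (simp add: boxed_def)
      moreover have "boxed w \<subseteq> u" using world_trans[OF w v(2) u(2)] .
      ultimately show "\<psi> \<in> top_world w" using u(1) by (intro memI)
    qed
  next
    assume "\<phi> \<in> top_world w \<longrightarrow> \<psi> \<in> top_world w"
    then consider "\<^bold>\<not> \<phi> \<in> top_world w" | "\<psi> \<in> top_world w" using neg by blast
    then show "\<phi> \<^bold>\<longrightarrow> \<psi> \<in> top_world w"
      by cases (auto intro: top_Imp simp: tautology_def)
  qed
qed

lemma boxed_le_top_world: "world w \<Longrightarrow> world v \<Longrightarrow> boxed w \<subseteq> v \<Longrightarrow> boxed v \<subseteq> top_world w"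
  by (auto simp: top_world_def world_Dia boxed_def)

lemma boxed_top_world:
  assumes "world w"
  shows "boxed (top_world w) = top_world w"
proof
  show "boxed (top_world w) \<subseteq> top_world w" using boxed_subset top_world_world assms by blast
  show "top_world w \<subseteq> boxed (top_world w)"
  proof
    fix \<phi> assume "\<phi> \<in> top_world w"
    then obtain v where v: "world v" "boxed w \<subseteq> v" "\<phi> \<in> boxed v"
      by (auto simp: top_world_def world_Dia[OF assms] boxed_def)
    have "\<box> \<box> \<phi> \<in> v" using boxed_Box[OF v(1,3)] by (simp add: boxed_def)
    then show "\<phi> \<in> boxed (top_world w)"
      using v(1,2) by (auto simp: top_world_def world_Dia[OF assms] boxed_def)
  qed
qed

text \<open>By reflexivity and maximality the final cluster is a single world, so points stopping at
  this level have only one possible label.\<close>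

lemma boxed_eq_top_world:
  assumes "world w" "world v" "boxed v = top_world w"
  shows "v = top_world w"
  using world_maximal[of "top_world w" v] boxed_subset[OF assms(2)] top_world_world[OF assms(1)] assms by simp

end

section \<open>The model on \<open>\<beta>\<omega>\<close>\<close>

lemma free_ultrafilter_exists:
  assumes "infinite A"
  obtains U where "free_ultrafilter U" "A \<in> members U"
proof -
  obtain U where "ultrafilter U" "A \<in> members U" "\<And>Z. Z \<in> {Z. finite Z} \<Longrightarrow> Z \<notin> members U"
    using assms by (rule_tac ultrafilter_avoiding[of "{Z. finite Z}" A]) (auto intro: finite_subset)
  then show ?thesis using that unfolding free_ultrafilter_def by blast
qed

text \<open>A history lists the sets entered so far, each with the set of formulas \<open>\<psi>\<close> such that \<open>\<box> \<psi>\<close> holds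
  throughout the corresponding clopen set; its stage is the intersection of these clopen sets.\<close>

type_synonym history = "(nat set \<times> fm set) set"

definition level :: "history \<Rightarrow> fm set" where
  "level h = \<Union>(snd ` h)"

section \<open>Histories and the labels available at a stage\<close>

locale beta_model = separable_mad \<A> + s412_theory \<Gamma> for \<A> \<Gamma> +
  fixes w\<^sub>0 :: "fm set"
  assumes root: "world w\<^sub>0"
begin

text \<open>The last clause makes a history a chain in which the sets shrink as the formulas grow.
  The order of entering can be read off the pairs, so a plain set replaces a sequence.\<close>

definition good :: "history \<Rightarrow> bool" where
  "good h \<longleftrightarrow> h \<noteq> {} \<and>
     (\<forall>c\<in>h. infinite (fst c) \<and> boxed w\<^sub>0 \<subseteq> snd c \<and> (\<exists>w. world w \<and> boxed w = snd c)) \<and>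
     (\<forall>c\<in>h. \<forall>d\<in>h. c = d \<or> (fst c \<subset>\<^sup>* fst d \<and> snd d \<subset> snd c) \<or> (fst d \<subset>\<^sup>* fst c \<and> snd c \<subset> snd d))"

text \<open>The third clause feeds the box case of the truth lemma: failures in the current cluster
  are seen at nearby stopping points, failures strictly above it in the cluster of a nearby child.
  The last clause ensures that some path stops right after a child is entered.\<close>

definition labelled_stage :: "history \<Rightarrow> history \<Rightarrow> (nat filter \<Rightarrow> fm set) \<Rightarrow> bool" where
  "labelled_stage h C l \<longleftrightarrow>
     (\<forall>c\<in>C. infinite (fst c) \<and> (\<exists>w. world w \<and> boxed w = snd c) \<and> level h \<subset> snd c \<and>
        (\<forall>A\<in>fst ` h. fst c \<subset>\<^sup>* A)) \<and>
     (\<forall>c\<in>C. \<forall>d\<in>C. c \<noteq> d \<longrightarrow> finite (fst c \<inter> fst d)) \<and>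
     (\<forall>x\<in>remainder (fst ` h) (fst ` C). world (l x) \<and> boxed (l x) = level h \<and>
        (\<forall>X\<in>members x. \<forall>v \<psi>. world v \<longrightarrow> \<psi> \<notin> v \<longrightarrow>
          (boxed v = level h \<longrightarrow> (\<exists>y\<in>remainder (fst ` h) (fst ` C). X \<in> members y \<and> \<psi> \<notin> l y)) \<and>
          (level h \<subset> boxed v \<longrightarrow>
            (\<exists>c\<in>C. fst c \<subseteq>\<^sup>* X \<and> (\<exists>v'. world v' \<and> boxed v' = snd c \<and> \<psi> \<notin> v'))))) \<and>
     ((\<exists>A\<in>fst ` h. \<forall>A'\<in>fst ` h. A = A' \<or> A \<subset>\<^sup>* A') \<longrightarrow> remainder (fst ` h) (fst ` C) \<noteq> {})"

abbreviation top where "top \<equiv> top_world w\<^sub>0"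

lemma world_top: "world top"
  using top_world_world root by blast

lemma boxed_top: "boxed top = top"
  using boxed_top_world root by blast

lemma boxed_le_top: "world v \<Longrightarrow> boxed w\<^sub>0 \<subseteq> boxed v \<Longrightarrow> boxed v \<subseteq> top"
  using boxed_le_top_world[OF root] boxed_subset by blast

lemma good_comparable:
  "good h \<Longrightarrow> c \<in> h \<Longrightarrow> d \<in> h \<Longrightarrow>
    c = d \<or> (fst c \<subset>\<^sup>* fst d \<and> snd d \<subset> snd c) \<or> (fst d \<subset>\<^sup>* fst c \<and> snd c \<subset> snd d)"
  unfolding good_def by (elim conjE) (drule (1) bspec)+

lemma good_level:
  assumes "good h"
  obtains w where "world w" "boxed w = level h" "boxed w\<^sub>0 \<subseteq> level h" "level h \<subseteq> top"
proof -
  obtain w where w: "world w" "boxed w = level h"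
  proof (rule limit_world[of "snd ` h"])
    fix S T assume "S \<in> snd ` h" "T \<in> snd ` h"
    then show "S \<subseteq> T \<or> T \<subseteq> S" using good_comparable[OF assms] by fastforce
  qed (use assms in \<open>auto simp: good_def level_def\<close>)
  have below: "boxed w\<^sub>0 \<subseteq> level h" using assms unfolding good_def level_def by blast
  then have "level h \<subseteq> top" using boxed_le_top[OF w(1)] w(2) by simp
  with w below show ?thesis by (rule that)
qed

text \<open>Countability of the language enters here. The entry chosen after the \<open>n\<close>th
  contains the \<open>n\<close>th formula if the level does; a given entry misses some formula of
  the level and is therefore eventually passed.\<close>

lemma good_cofinal_sequence:
  assumes h: "good h" and unattained: "\<And>c. c \<in> h \<Longrightarrow> snd c \<noteq> level h"
  obtains A where "\<And>n::nat. A n \<in> fst ` h" "\<And>n. A (Suc n) \<subset>\<^sup>* A n"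
    "\<And>C. C \<in> fst ` h \<Longrightarrow> \<exists>n. A n \<subseteq>\<^sup>* C"
proof -
  have cmp: "c = d \<or> (fst c \<subset>\<^sup>* fst d \<and> snd d \<subset> snd c) \<or> (fst d \<subset>\<^sup>* fst c \<and> snd c \<subset> snd d)"
    if "c \<in> h" "d \<in> h" for c d using good_comparable[OF h that] .
  have beyond: "\<exists>d\<in>h. fst d \<subset>\<^sup>* fst c \<and> snd c \<subset> snd d" if c: "c \<in> h" for c
  proof -
    have "snd c \<subseteq> level h" using c by (auto simp: level_def)
    then obtain \<psi> where "\<psi> \<in> level h" "\<psi> \<notin> snd c" using unattained[OF c] by blast
    then obtain d where "d \<in> h" "\<psi> \<in> snd d" by (auto simp: level_def)
    then show ?thesis using cmp[OF c \<open>d \<in> h\<close>] \<open>\<psi> \<notin> snd c\<close> by blast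
  qed
  define \<psi> :: "nat \<Rightarrow> fm" where "\<psi> = from_nat"
  have "\<exists>c'. c' \<in> h \<and> fst c' \<subset>\<^sup>* fst c \<and> (\<psi> n \<in> level h \<longrightarrow> \<psi> n \<in> snd c')" if c: "c \<in> h" for c n
  proof -
    obtain d where d: "d \<in> h" "fst d \<subset>\<^sup>* fst c" using beyond[OF c] by blast
    show ?thesis
    proof (cases "\<psi> n \<in> level h")
      case True
      then obtain e where e: "e \<in> h" "\<psi> n \<in> snd e" by (auto simp: level_def)
      show ?thesis
      proof (cases "fst e \<subset>\<^sup>* fst d")
        case True
        then show ?thesis using e d almost_psubset_trans1 almost_psubset_imp_subset by blast
      next
        case False
        then show ?thesis using cmp[OF e(1) d(1)] d e by blast
      qed
    qed (use d in blast)
  qed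
  moreover have "\<exists>c. c \<in> h" using h by (auto simp: good_def)
  ultimately obtain c where c: "\<And>n. c n \<in> h" "\<And>n. fst (c (Suc n)) \<subset>\<^sup>* fst (c n)"
    "\<And>n. \<psi> n \<in> level h \<longrightarrow> \<psi> n \<in> snd (c (Suc n))"
    using dependent_nat_choice[of "\<lambda>_ c. c \<in> h"
        "\<lambda>n c c'. fst c' \<subset>\<^sup>* fst c \<and> (\<psi> n \<in> level h \<longrightarrow> \<psi> n \<in> snd c')"] by metis
  show ?thesis
  proof
    fix C assume "C \<in> fst ` h"
    then obtain d where d: "d \<in> h" "C = fst d" by blast
    have "snd d \<subseteq> level h" using d by (auto simp: level_def)
    then obtain \<theta> where \<theta>: "\<theta> \<in> level h" "\<theta> \<notin> snd d" using unattained[OF d(1)] by blast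
    have "\<psi> (to_nat \<theta>) = \<theta>" by (simp add: \<psi>_def)
    then have "\<theta> \<in> snd (c (Suc (to_nat \<theta>)))" using c(3)[of "to_nat \<theta>"] \<theta> by simp
    then have "fst (c (Suc (to_nat \<theta>))) \<subset>\<^sup>* C"
      using cmp[OF d(1) c(1)[of "Suc (to_nat \<theta>)"]] \<theta> d(2) by blast
    then show "\<exists>n. fst (c n) \<subseteq>\<^sup>* C" using almost_psubset_imp_subset by blast
  qed (use c in auto)
qed

text \<open>An entry attaining the level would carry the least set, so without a least set
  \<open>good_cofinal_sequence\<close> applies.\<close>

lemma good_stage_family:
  assumes h: "good h"
  obtains \<B> where "stage_family (fst ` h) \<B>"
    "(\<exists>A\<in>fst ` h. \<forall>A'\<in>fst ` h. A = A' \<or> A \<subset>\<^sup>* A') \<longrightarrow> remainder (fst ` h) \<B> \<noteq> {}"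
proof (cases "\<exists>A\<in>fst ` h. \<forall>A'\<in>fst ` h. A = A' \<or> A \<subset>\<^sup>* A'")
  case True
  then obtain A where A: "A \<in> fst ` h" "\<And>A'. A' \<in> fst ` h \<Longrightarrow> A = A' \<or> A \<subset>\<^sup>* A'" by blast
  have "infinite A" using A(1) h by (auto simp: good_def)
  then show ?thesis using stage_family_min[OF A(1) _ A(2)] that by metis
next
  case False
  have "snd c \<noteq> level h" if c: "c \<in> h" for c
  proof
    assume eq: "snd c = level h"
    have "fst c = fst d \<or> fst c \<subset>\<^sup>* fst d" if d: "d \<in> h" for d
    proof -
      have "\<not> snd c \<subset> snd d" using d eq by (auto simp: level_def)
      then show ?thesis using good_comparable[OF h c d] by blast
    qed
    then show False using False c by blast
  qed
  then obtain A :: "nat \<Rightarrow> nat set" where "\<And>n. A n \<in> fst ` h" "\<And>n. A (Suc n) \<subset>\<^sup>* A n"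
    "\<And>C. C \<in> fst ` h \<Longrightarrow> \<exists>n. A n \<subseteq>\<^sup>* C"
    using good_cofinal_sequence[OF h] by metis
  then obtain \<B> where "stage_family (fst ` h) \<B>" by (rule stage_family_limit)
  then show ?thesis using that False by blast
qed

lemma labelled_stage_exists:
  assumes h: "good h"
  shows "\<exists>C l. labelled_stage h C l"
proof -
  obtain w where w: "world w" "boxed w = level h" "boxed w\<^sub>0 \<subseteq> level h" "level h \<subseteq> top"
    using good_level[OF h] .
  show ?thesis
  proof (cases "level h = top")
    case True \<comment> \<open>no strictly larger level exists, so the path has to stop\<close>
    have uniq: "v = top" if "world v" "boxed v = level h" for v
      using boxed_eq_top_world[OF root] that True by simp
    have maximal: "\<not> level h \<subset> boxed v" if "world v" for v
      using boxed_le_top[OF that] w(3) True by blast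
    have nonempty: "remainder (fst ` h) {} \<noteq> {}"
      if "A \<in> fst ` h" and A: "\<forall>A'\<in>fst ` h. A = A' \<or> A \<subset>\<^sup>* A'" for A
    proof -
      have "infinite A" using that(1) h by (auto simp: good_def)
      then obtain U where U: "free_ultrafilter U" "A \<in> members U" by (rule free_ultrafilter_exists)
      have "fst ` h \<subseteq> members U"
      proof
        fix A' assume "A' \<in> fst ` h"
        then consider "A = A'" | "A \<subset>\<^sup>* A'" using A by blast
        then show "A' \<in> members U"
          by cases (use U members_almost_mono[OF U almost_psubset_imp_subset] in simp_all)
      qed
      then show ?thesis using U by (auto simp: remainder_def)
    qed
    have "labelled_stage h {} (\<lambda>_. top)"
      unfolding labelled_stage_def image_empty
    proof (intro conjI impI ballI allI)
      assume "\<exists>A\<in>fst ` h. \<forall>A'\<in>fst ` h. A = A' \<or> A \<subset>\<^sup>* A'"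
      then obtain A where "A \<in> fst ` h" "\<forall>A'\<in>fst ` h. A = A' \<or> A \<subset>\<^sup>* A'" by blast
      then show "remainder (fst ` h) {} \<noteq> {}" by (rule nonempty)
    qed (use world_top boxed_top True uniq maximal in blast)+
    then show ?thesis by blast
  next
    case False
    obtain \<B> where \<B>: "stage_family (fst ` h) \<B>"
      and min: "(\<exists>A\<in>fst ` h. \<forall>A'\<in>fst ` h. A = A' \<or> A \<subset>\<^sup>* A') \<longrightarrow> remainder (fst ` h) \<B> \<noteq> {}"
      using good_stage_family[OF h] .
    let ?R = "remainder (fst ` h) \<B>"
    \<comment> \<open>All neighbourhoods of stopping points; each must see every colour, among
      children and among stopping points. Colours are codes of formulas.\<close>
    let ?P = "{X. \<exists>x\<in>?R. X \<in> members x}"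
    obtain kB :: "nat set \<Rightarrow> nat" where kB: "\<And>X k. X \<in> ?P \<Longrightarrow> \<exists>B\<in>{B \<in> \<B>. B \<subseteq>\<^sup>* X}. kB B = k"
      by (rule dense_labelling[of ?P "\<lambda>X. {B \<in> \<B>. B \<subseteq>\<^sup>* X}"]) (use \<B> in \<open>auto simp: stage_family_def\<close>)
    obtain kR :: "nat filter \<Rightarrow> nat" where kR: "\<And>X k. X \<in> ?P \<Longrightarrow> \<exists>y\<in>{y \<in> ?R. X \<in> members y}. kR y = k"
      by (rule dense_labelling[of ?P "\<lambda>X. {y \<in> ?R. X \<in> members y}"]) (use \<B> in \<open>auto simp: stage_family_def\<close>)
    have "level h \<subset> boxed top" using boxed_top w(4) False by simp
    \<comment> \<open>The world for colour \<open>\<psi>\<close> refutes \<open>\<psi>\<close> if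
      any world strictly above the level does; otherwise \<open>top\<close> serves as the
      default.\<close>
    then have "\<exists>v'. world v' \<and> level h \<subset> boxed v' \<and>
        ((\<exists>v. world v \<and> level h \<subset> boxed v \<and> \<psi> \<notin> v) \<longrightarrow> \<psi> \<notin> v')" for \<psi>
      using world_top by blast
    then obtain u where u: "\<And>\<psi>. world (u \<psi>)" "\<And>\<psi>. level h \<subset> boxed (u \<psi>)"
      "\<And>\<psi> v. world v \<Longrightarrow> level h \<subset> boxed v \<Longrightarrow> \<psi> \<notin> v \<Longrightarrow> \<psi> \<notin> u \<psi>" by metis
    have "\<exists>v'. world v' \<and> boxed v' = level h \<and>
        ((\<exists>v. world v \<and> boxed v = level h \<and> \<psi> \<notin> v) \<longrightarrow> \<psi> \<notin> v')" for \<psi>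
      using w by blast
    then obtain r where r: "\<And>\<psi>. world (r \<psi>)" "\<And>\<psi>. boxed (r \<psi>) = level h"
      "\<And>\<psi> v. world v \<Longrightarrow> boxed v = level h \<Longrightarrow> \<psi> \<notin> v \<Longrightarrow> \<psi> \<notin> r \<psi>" by metis
    define C where "C = (\<lambda>B. (B, boxed (u (from_nat (kB B))))) ` \<B>"
    define l where "l y = r (from_nat (kR y))" for y
    have fC: "fst ` C = \<B>" by (auto simp: C_def image_image)
    have "labelled_stage h C l"
      unfolding labelled_stage_def fC
    proof (intro conjI min ballI allI impI)
      fix c assume "c \<in> C"
      then obtain B where B: "B \<in> \<B>" "c = (B, boxed (u (from_nat (kB B))))" by (auto simp: C_def)
      show "infinite (fst c)" "\<And>A. A \<in> fst ` h \<Longrightarrow> fst c \<subset>\<^sup>* A"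
        using B \<B> by (auto simp: stage_family_def)
      show "\<exists>w. world w \<and> boxed w = snd c" "level h \<subset> snd c" using B u by auto
      fix d assume "d \<in> C" "c \<noteq> d"
      then obtain B' where B': "B' \<in> \<B>" "d = (B', boxed (u (from_nat (kB B'))))"
        unfolding C_def by blast
      then have "B \<noteq> B'" using \<open>c \<noteq> d\<close> B(2) by metis
      then show "finite (fst c \<inter> fst d)"
        using B B' conjunct1[OF conjunct2[OF \<B>[unfolded stage_family_def]]] by simp
    next
      fix x show "world (l x)" "boxed (l x) = level h" using r by (simp_all add: l_def)
    next
      fix x X v \<psi> assume x: "x \<in> ?R" "X \<in> members x" and v: "world v" "\<psi> \<notin> v" "boxed v = level h"
      have "X \<in> ?P" using x by blast
      then obtain y where "y \<in> ?R" "X \<in> members y" "kR y = to_nat \<psi>" using kR by blast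
      then show "\<exists>y\<in>?R. X \<in> members y \<and> \<psi> \<notin> l y" using r(3) v by (auto simp: l_def)
    next
      fix x X v \<psi> assume x: "x \<in> ?R" "X \<in> members x" and v: "world v" "\<psi> \<notin> v" "level h \<subset> boxed v"
      have "X \<in> ?P" using x by blast
      then obtain B where B: "B \<in> \<B>" "B \<subseteq>\<^sup>* X" "kB B = to_nat \<psi>" using kB by blast
      then have "(B, boxed (u \<psi>)) \<in> C" by (force simp: C_def)
      then show "\<exists>c\<in>C. fst c \<subseteq>\<^sup>* X \<and> (\<exists>v'. world v' \<and> boxed v' = snd c \<and> \<psi> \<notin> v')"
        using B u(1) u(3)[OF v(1,3,2)] by force
    qed
    then show ?thesis by blast
  qed
qed

text \<open>Meaningful only for good histories: otherwise the choice may be from an empty predicate.\<close>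

definition stage :: "history \<Rightarrow> history \<times> (nat filter \<Rightarrow> fm set)" where
  "stage h = (SOME p. labelled_stage h (fst p) (snd p))"

abbreviation children :: "history \<Rightarrow> history" where
  "children h \<equiv> fst (stage h)"

abbreviation boundary :: "history \<Rightarrow> nat filter set" where
  "boundary h \<equiv> remainder (fst ` h) (fst ` children h)"

lemma labelled_stage: "good h \<Longrightarrow> labelled_stage h (children h) (snd (stage h))"
  using labelled_stage_exists[of h] someI_ex[of "\<lambda>p. labelled_stage h (fst p) (snd p)"]
  unfolding stage_def by auto

lemma
  assumes h: "good h"
  shows child_conditions: "c \<in> children h \<Longrightarrow> infinite (fst c) \<and>
      (\<exists>w. world w \<and> boxed w = snd c) \<and> level h \<subset> snd c \<and> (\<forall>A\<in>fst ` h. fst c \<subset>\<^sup>* A)"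
    and children_almost_disjoint:
      "c \<in> children h \<Longrightarrow> d \<in> children h \<Longrightarrow> c \<noteq> d \<Longrightarrow> finite (fst c \<inter> fst d)"
    and boundary_conditions: "x \<in> boundary h \<Longrightarrow>
      world (snd (stage h) x) \<and> boxed (snd (stage h) x) = level h \<and>
      (\<forall>X\<in>members x. \<forall>v \<psi>. world v \<longrightarrow> \<psi> \<notin> v \<longrightarrow>
        (boxed v = level h \<longrightarrow> (\<exists>y\<in>boundary h. X \<in> members y \<and> \<psi> \<notin> snd (stage h) y)) \<and>
        (level h \<subset> boxed v \<longrightarrow>
          (\<exists>c\<in>children h. fst c \<subseteq>\<^sup>* X \<and> (\<exists>v'. world v' \<and> boxed v' = snd c \<and> \<psi> \<notin> v'))))"
    and boundary_nonempty:
      "\<exists>A\<in>fst ` h. \<forall>A'\<in>fst ` h. A = A' \<or> A \<subset>\<^sup>* A' \<Longrightarrow> boundary h \<noteq> {}"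
proof -
  note L = labelled_stage[OF h, unfolded labelled_stage_def]
  note L' = conjunct2[OF L] and L'' = conjunct2[OF conjunct2[OF L]]
  show "c \<in> children h \<Longrightarrow> infinite (fst c) \<and>
      (\<exists>w. world w \<and> boxed w = snd c) \<and> level h \<subset> snd c \<and> (\<forall>A\<in>fst ` h. fst c \<subset>\<^sup>* A)"
    by (rule bspec[OF conjunct1[OF L]])
  show "c \<in> children h \<Longrightarrow> d \<in> children h \<Longrightarrow> c \<noteq> d \<Longrightarrow> finite (fst c \<inter> fst d)"
    by (rule HOL.mp[OF bspec[OF bspec[OF conjunct1[OF L']]]])
  show "x \<in> boundary h \<Longrightarrow>
      world (snd (stage h) x) \<and> boxed (snd (stage h) x) = level h \<and>
      (\<forall>X\<in>members x. \<forall>v \<psi>. world v \<longrightarrow> \<psi> \<notin> v \<longrightarrow>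
        (boxed v = level h \<longrightarrow> (\<exists>y\<in>boundary h. X \<in> members y \<and> \<psi> \<notin> snd (stage h) y)) \<and>
        (level h \<subset> boxed v \<longrightarrow>
          (\<exists>c\<in>children h. fst c \<subseteq>\<^sup>* X \<and> (\<exists>v'. world v' \<and> boxed v' = snd c \<and> \<psi> \<notin> v'))))"
    by (rule bspec[OF conjunct1[OF L'']])
  show "\<exists>A\<in>fst ` h. \<forall>A'\<in>fst ` h. A = A' \<or> A \<subset>\<^sup>* A' \<Longrightarrow> boundary h \<noteq> {}"
    by (rule HOL.mp[OF conjunct2[OF L'']])
qed

lemma child:
  assumes "good h" "c \<in> children h"
  shows "infinite (fst c)" "\<exists>w. world w \<and> boxed w = snd c" "level h \<subset> snd c"
    "\<And>d. d \<in> h \<Longrightarrow> fst c \<subset>\<^sup>* fst d"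
  using child_conditions[OF assms] by (elim conjE; simp)+

lemma child_not_member: "good h \<Longrightarrow> c \<in> children h \<Longrightarrow> c \<notin> h"
  using child(3) by (fastforce simp: level_def)

lemma child_unique:
  assumes "good h" "c \<in> children h" "d \<in> children h"
    and x: "free_ultrafilter x" "fst c \<in> members x" "fst d \<in> members x"
  shows "c = d"
  using children_almost_disjoint[OF assms(1-3)] members_finite_Int[OF x(1,2), of "fst d"] x(3) by blast

lemma good_insert_child:
  assumes h: "good h" and c: "c \<in> children h"
  shows "good (insert c h)"
proof -
  have new: "fst c \<subset>\<^sup>* fst d \<and> snd d \<subset> snd c" if "d \<in> h" for d
    using child(3,4)[OF h c] that by (auto simp: level_def)
  have "boxed w\<^sub>0 \<subseteq> snd c"
    using good_level[OF h] child(3)[OF h c] by (metis order_trans psubset_imp_subset)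
  then have each: "infinite (fst d) \<and> boxed w\<^sub>0 \<subseteq> snd d \<and> (\<exists>w. world w \<and> boxed w = snd d)"
    if "d \<in> insert c h" for d
    using that child(1,2)[OF h c] h unfolding good_def by (elim insertE) simp_all
  have comparable: "d = e \<or> (fst d \<subset>\<^sup>* fst e \<and> snd e \<subset> snd d) \<or> (fst e \<subset>\<^sup>* fst d \<and> snd d \<subset> snd e)"
    if "d \<in> insert c h" "e \<in> insert c h" for d e
    using that new good_comparable[OF h] by (elim insertE) simp_all
  show ?thesis
    unfolding good_def by (intro conjI[OF insert_not_empty conjI] ballI each comparable)
qed

lemma level_insert_child: "good h \<Longrightarrow> c \<in> children h \<Longrightarrow> level (insert c h) = snd c"
  using child(3)[of h c] by (auto simp: level_def)

text \<open>At most one child belongs to a given free ultrafilter, so that a step adds at most one pair.\<close>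

definition advance :: "nat filter \<Rightarrow> history \<Rightarrow> history" where
  "advance x h = h \<union> {c \<in> children h. fst c \<in> members x}"

lemma advance_child:
  assumes "good h" "c \<in> children h" "free_ultrafilter x" "fst c \<in> members x"
  shows "advance x h = insert c h"
proof -
  have "{d \<in> children h. fst d \<in> members x} = {c}"
    using assms(2,4) child_unique[OF assms(1,2) _ assms(3,4)] by blast
  then show ?thesis by (simp add: advance_def)
qed

lemma advance_cases:
  assumes "good h" "free_ultrafilter x"
  obtains "advance x h = h" "\<And>c. c \<in> children h \<Longrightarrow> fst c \<notin> members x"
  | c where "c \<in> children h" "fst c \<in> members x" "advance x h = insert c h"
proof (cases "\<exists>c\<in>children h. fst c \<in> members x")
  case True
  then obtain c where "c \<in> children h" "fst c \<in> members x" by blast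
  then show ?thesis using that(2) advance_child assms by blast
next
  case False
  then show ?thesis using that(1) by (auto simp: advance_def)
qed

section \<open>Transfinite paths\<close>

abbreviation root_history :: history where
  "root_history \<equiv> {(UNIV, boxed w\<^sub>0)}"

text \<open>Iterates of \<open>advance x\<close> with unions at limits stand in for stages indexed
  by ordinals.\<close>

abbreviation histories :: "nat filter \<Rightarrow> history set" where
  "histories x \<equiv> bourbaki_witt_fixpoint.iterates_above Union {(a, b). a \<subseteq> b} (advance x) root_history"

definition path :: "nat filter \<Rightarrow> history" where
  "path x = bourbaki_witt_fixpoint.fixp_above Union {(a, b). a \<subseteq> b} (advance x) root_history"

lemma Field_subset_relation: "Field {(a :: 'a set, b). a \<subseteq> b} = UNIV"
  by (auto simp: Field_def)

lemma bourbaki_witt: "bourbaki_witt_fixpoint Union {(a, b). a \<subseteq> b} (advance x)"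
proof
  show "Partial_order {(a :: history, b). a \<subseteq> b}"
    unfolding partial_order_on_def preorder_on_def Field_subset_relation
    by (auto simp: refl_on_def trans_def antisym_def)
qed (auto simp: Field_subset_relation advance_def)

lemmas histories_root = bourbaki_witt_fixpoint.iterates_above.base[OF bourbaki_witt]
lemmas histories_advance = bourbaki_witt_fixpoint.iterates_above.step[OF bourbaki_witt]
lemmas histories_Union = bourbaki_witt_fixpoint.iterates_above.Sup[OF bourbaki_witt]
lemmas histories_induct [consumes 1, case_names root advance Union] =
  bourbaki_witt_fixpoint.iterates_above.induct[OF bourbaki_witt]

lemma path_history: "path x \<in> histories x"
  unfolding path_def by (rule bourbaki_witt_fixpoint.fixp_iterates_above[OF bourbaki_witt])

lemma advance_path: "advance x (path x) = path x"
  unfolding path_def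
  by (rule bourbaki_witt_fixpoint.fixp_above_unfold[OF bourbaki_witt, symmetric]) (simp add: Field_subset_relation)

lemma history_subset_path: "h \<in> histories x \<Longrightarrow> h \<subseteq> path x"
  using bourbaki_witt_fixpoint.fixp_above_inside[OF bourbaki_witt, of root_history x]
  by (auto simp: path_def Field_subset_relation)

text \<open>Of two iterates one is an iterate of the other, and iterating from a fixed point yields
  nothing new.\<close>

lemma path_eq_fixpoint:
  assumes h: "h \<in> histories x" and fix_h: "advance x h = h"
  shows "path x = h"
proof -
  have stay: "y = h" if "y \<in> bourbaki_witt_fixpoint.iterates_above Union {(a, b). a \<subseteq> b} (advance x) h" for y
    using that
  proof (induction rule: bourbaki_witt_fixpoint.iterates_above.induct[OF bourbaki_witt, consumes 1, case_names base step Sup])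
    case (Sup M)
    then have "M = {h}" by blast
    then show ?case by simp
  qed (simp_all add: fix_h)
  have "path x \<in> bourbaki_witt_fixpoint.iterates_above Union {(a, b). a \<subseteq> b} (advance x) h \<or>
      h \<in> bourbaki_witt_fixpoint.iterates_above Union {(a, b). a \<subseteq> b} (advance x) (path x)"
    by (rule bourbaki_witt_fixpoint.iterates_above_triangle[OF bourbaki_witt path_history h])
      (simp add: Field_subset_relation)
  moreover have "path x \<subseteq> h" if "h \<in> bourbaki_witt_fixpoint.iterates_above Union {(a, b). a \<subseteq> b} (advance x) (path x)"
    using bourbaki_witt_fixpoint.iterates_above_ge[OF bourbaki_witt that] by (simp add: Field_subset_relation)
  ultimately show ?thesis using stay history_subset_path[OF h] by blast
qed

lemma good_root: "good root_history"
  using root by (auto simp: good_def)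

lemma history_good:
  assumes x: "free_ultrafilter x" and "h \<in> histories x"
  shows "good h \<and> fst ` h \<subseteq> members x"
  using assms(2)
proof (induction rule: histories_induct)
  case root
  have "UNIV \<in> members x" by (simp add: members_def)
  then show ?case using good_root by simp
next
  case (advance h)
  then show ?case
    by (cases rule: advance_cases[OF conjunct1[OF advance.IH] x]) (auto intro: good_insert_child)
next
  case (Union M)
  have two: "\<exists>h\<in>M. c \<in> h \<and> d \<in> h" if "c \<in> \<Union>M" "d \<in> \<Union>M" for c d
    using that Union.hyps(1) unfolding Chains_def by blast
  have "good (\<Union>M)"
    unfolding good_def
  proof (intro conjI ballI)
    show "\<Union>M \<noteq> {}" using Union.IH Union.hyps(2) by (fastforce simp: good_def)
    fix c assume c: "c \<in> \<Union>M"
    then obtain h where h: "h \<in> M" "c \<in> h" by blast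
    then show "infinite (fst c)" "boxed w\<^sub>0 \<subseteq> snd c" "\<exists>w. world w \<and> boxed w = snd c"
      using Union.IH by (auto simp: good_def)
    fix d assume "d \<in> \<Union>M"
    then obtain h' where h': "h' \<in> M" "c \<in> h'" "d \<in> h'" using two c by blast
    show "c = d \<or> (fst c \<subset>\<^sup>* fst d \<and> snd d \<subset> snd c) \<or> (fst d \<subset>\<^sup>* fst c \<and> snd c \<subset> snd d)"
      using good_comparable[OF conjunct1[OF Union.IH[OF h'(1)]] h'(2,3)] .
  qed
  then show ?case using Union.IH by blast
qed

text \<open>A step depends on the ultrafilter only through the child that it contains, and the sets
  entered along \<open>h\<close> belong to \<open>y\<close> too.\<close>

lemma history_transfer:
  assumes x: "free_ultrafilter x" and y: "free_ultrafilter y"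
    and "h \<in> histories x" and "fst ` h \<subseteq> members y"
  shows "h \<in> histories y"
  using assms(3,4)
proof (induction rule: histories_induct)
  case root
  show ?case by (rule histories_root)
next
  case (advance h)
  have h: "good h" using history_good[OF x] advance.hyps by blast
  show ?case
  proof (cases rule: advance_cases[OF h x])
    case 1
    then show ?thesis using advance by simp
  next
    case (2 c)
    then have "advance y h = insert c h" using advance_child[OF h _ y] advance.prems by simp
    moreover have "h \<in> histories y" using advance 2 by simp
    ultimately show ?thesis using histories_advance[of h y] 2 by simp
  qed
next
  case (Union M)
  have "h \<in> histories y" if "h \<in> M" for h using Union that by blast
  then show ?case using histories_Union[OF Union.hyps(1,2)] by blast
qed

text \<open>The witness is the history just after \<open>c\<close> is entered, as a child is almost
  contained in all earlier sets.\<close>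

lemma history_truncate:
  assumes x: "free_ultrafilter x" and "h \<in> histories x" and "c \<in> h"
  shows "\<exists>h'\<in>histories x. c \<in> h' \<and> (\<forall>d\<in>h'. fst c \<subseteq>\<^sup>* fst d)"
  using assms(2,3)
proof (induction rule: histories_induct)
  case root
  then show ?case using histories_root by (intro bexI[of _ root_history]) (auto simp: almost_subset_def)
next
  case (advance h)
  have h: "good h" using history_good[OF x] advance.hyps by blast
  show ?case
  proof (cases "c \<in> h")
    case False
    then have c: "c \<in> children h" "fst c \<in> members x" using advance.prems by (auto simp: advance_def)
    then have "advance x h = insert c h" using advance_child h x by blast
    moreover have "fst c \<subseteq>\<^sup>* fst d" if "d \<in> insert c h" for d
    proof (cases "d = c")
      case False
      then show ?thesis using that child(4)[OF h c(1), of d] almost_psubset_imp_subset by blast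
    qed (simp add: almost_subset_def)
    ultimately show ?thesis using histories_advance[OF advance.hyps] by (intro bexI[of _ "advance x h"]) auto
  qed (use advance in blast)
qed blast

text \<open>The sets of the history truncated at \<open>c\<close> almost contain
  \<open>fst c\<close>, so they belong to \<open>y\<close>. Hence the formulas in
  \<open>snd c\<close> are boxed at every free ultrafilter containing \<open>fst c\<close>.\<close>

lemma path_shared:
  assumes x: "free_ultrafilter x" and y: "free_ultrafilter y"
    and c: "c \<in> path x" "fst c \<in> members y"
  shows "c \<in> path y"
proof -
  obtain h where h: "h \<in> histories x" "c \<in> h" "\<forall>d\<in>h. fst c \<subseteq>\<^sup>* fst d"
    using history_truncate[OF x path_history c(1)] by blast
  then have "fst ` h \<subseteq> members y" using members_almost_mono[OF y c(2)] by blast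
  then show ?thesis using history_transfer[OF x y h(1)] h(2) history_subset_path by blast
qed

section \<open>Stopping points and the labelling\<close>

lemma boundary_path:
  assumes x: "free_ultrafilter x"
  shows "x \<in> boundary (path x)"
proof -
  have g: "good (path x)" "fst ` path x \<subseteq> members x" using history_good[OF x path_history] by auto
  have "fst c \<notin> members x" if c: "c \<in> children (path x)" for c
    using advance_child[OF g(1) c x] advance_path child_not_member[OF g(1) c] by auto
  then show ?thesis using x g by (auto simp: remainder_def)
qed

text \<open>The history transfers to \<open>y\<close>, which contains no child and so makes it a
  fixed point. Thus the labels chosen on the boundary of \<open>h\<close> are those that
  \<open>label\<close> uses.\<close>

lemma path_boundary:
  assumes x: "free_ultrafilter x" and h: "h \<in> histories x" and y: "y \<in> boundary h"
  shows "path y = h"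
proof (rule path_eq_fixpoint)
  show "h \<in> histories y" using history_transfer[OF x _ h] y by (auto simp: remainder_def)
  show "advance y h = h" using y by (auto simp: remainder_def advance_def)
qed

text \<open>An isolated point satisfies a formula iff it satisfies its box, so a principal
  ultrafilter needs a world equal to its own \<open>boxed\<close> set; \<open>top\<close> is one by
  \<open>boxed_top\<close>.\<close>

definition label :: "nat filter \<Rightarrow> fm set" where
  "label x = (if free_ultrafilter x then snd (stage (path x)) x else top)"

lemma label_free:
  assumes x: "free_ultrafilter x"
  shows "world (label x)" "boxed (label x) = level (path x)"
  using boundary_conditions[OF conjunct1[OF history_good[OF x path_history]] boundary_path[OF x]] x
  by (simp_all add: label_def)

lemma world_label: "world (label x)"
  using label_free(1) world_top by (cases "free_ultrafilter x") (auto simp: label_def)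

lemma boundary_realizes:
  assumes x: "free_ultrafilter x" and h: "h \<in> histories x" and y: "y \<in> boundary h" "X \<in> members y"
    and v: "world v" "boxed v = level h" "\<psi> \<notin> v"
  shows "\<exists>z. free_ultrafilter z \<and> X \<in> members z \<and> \<psi> \<notin> label z"
proof -
  have "good h" using history_good[OF x h] by blast
  then obtain z where z: "z \<in> boundary h" "X \<in> members z" "\<psi> \<notin> snd (stage h) z"
    using boundary_conditions[OF _ y(1)] y(2) v by blast
  moreover have "free_ultrafilter z" using z(1) by (simp add: remainder_def)
  ultimately show ?thesis using path_boundary[OF x h z(1)] by (auto simp: label_def)
qed

lemma boundary_child_nonempty:
  assumes h: "good h" and c: "c \<in> children h"
  shows "\<exists>y. y \<in> boundary (insert c h)"
proof -
  have "\<exists>A\<in>fst ` insert c h. \<forall>A'\<in>fst ` insert c h. A = A' \<or> A \<subset>\<^sup>* A'"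
    using child(4)[OF h c] by (intro bexI[of _ "fst c"]) auto
  then show ?thesis using boundary_nonempty[OF good_insert_child[OF h c]] by blast
qed

text \<open>A successor refuting \<open>\<psi>\<close> in the current cluster is matched by a
  boundary point of the same stage. One strictly above is replaced by a world of the cluster of a
  child almost inside \<open>X\<close>, matched on the boundary of the history extended by that
  child.\<close>

lemma label_realizes:
  assumes x: "free_ultrafilter x" and X: "X \<in> members x" and \<psi>: "\<psi> \<notin> boxed (label x)"
  shows "\<exists>z. free_ultrafilter z \<and> X \<in> members z \<and> \<psi> \<notin> label z"
proof -
  define h where "h = path x"
  have h: "h \<in> histories x" "good h" "x \<in> boundary h"
    using path_history history_good[OF x path_history] boundary_path[OF x] by (auto simp: h_def)
  have lev: "boxed (label x) = level h" using label_free[OF x] by (simp add: h_def)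
  obtain v where v: "world v" "boxed (label x) \<subseteq> v" "\<psi> \<notin> v"
    using world_successor[OF label_free(1)[OF x] \<psi>] .
  have "level h \<subseteq> boxed v" using boxed_mono[OF label_free(1)[OF x] v(2)] lev by simp
  then consider "boxed v = level h" | "level h \<subset> boxed v" by blast
  then show ?thesis
  proof cases
    case 1
    then show ?thesis using boundary_realizes[OF x h(1,3) X v(1) _ v(3)] by blast
  next
    case 2
    then obtain c v' where c: "c \<in> children h" "fst c \<subseteq>\<^sup>* X" and v': "world v'" "boxed v' = snd c" "\<psi> \<notin> v'"
      using boundary_conditions[OF h(2,3)] X v(1,3) by blast
    obtain y where y: "y \<in> boundary (insert c h)" using boundary_child_nonempty[OF h(2) c(1)] by blast
    then have yf: "free_ultrafilter y" and yc: "fst c \<in> members y" and yh: "fst ` h \<subseteq> members y"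
      by (auto simp: remainder_def)
    have "insert c h \<in> histories y"
      using histories_advance[OF history_transfer[OF x yf h(1) yh]] advance_child[OF h(2) c(1) yf yc] by simp
    moreover have "boxed v' = level (insert c h)" using level_insert_child[OF h(2) c(1)] v'(2) by simp
    ultimately obtain z where "free_ultrafilter z" "fst c \<in> members z" "\<psi> \<notin> label z"
      using boundary_realizes[OF yf _ y yc v'(1) _ v'(3)] by blast
    then show ?thesis using members_almost_mono c(2) by blast
  qed
qed

lemma truth:
  assumes "ultrafilter x"
  shows "forces \<beta>\<omega> (\<lambda>p x. Var p \<in> label x) x \<phi> \<longleftrightarrow> \<phi> \<in> label x"
  using assms
proof (induction \<phi> arbitrary: x)
  case Fls
  then show ?case using world_Fls[OF world_label] by simp
next
  case (Imp \<phi> \<psi>)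
  then show ?case using world_Imp[OF world_label] by simp
next
  case (Box \<psi>)
  have IH: "(\<forall>y\<in>U. forces \<beta>\<omega> (\<lambda>p x. Var p \<in> label x) y \<psi>) \<longleftrightarrow> (\<forall>y\<in>U. \<psi> \<in> label y)"
    if "openin \<beta>\<omega> U" for U
    using Box.IH openin_subset[OF that] by (auto simp: topspace_beta)
  have "forces \<beta>\<omega> (\<lambda>p x. Var p \<in> label x) x (\<box> \<psi>) \<longleftrightarrow>
      (\<exists>U. openin \<beta>\<omega> U \<and> x \<in> U \<and> (\<forall>y\<in>U. \<psi> \<in> label y))"
    using IH by auto
  also have "\<dots> \<longleftrightarrow> \<psi> \<in> boxed (label x)"
  proof
    assume "\<exists>U. openin \<beta>\<omega> U \<and> x \<in> U \<and> (\<forall>y\<in>U. \<psi> \<in> label y)"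
    then obtain U where U: "openin \<beta>\<omega> U" "x \<in> U" "\<And>y. y \<in> U \<Longrightarrow> \<psi> \<in> label y" by blast
    obtain X where X: "x \<in> stone_set X" "stone_set X \<subseteq> U" using openin_beta U by blast
    show "\<psi> \<in> boxed (label x)"
    proof (cases "free_ultrafilter x")
      case True
      have "\<psi> \<in> label z" if "free_ultrafilter z" "X \<in> members z" for z
        using that X(2) U(3) by (auto simp: stone_set_members free_ultrafilter_def)
      then show ?thesis using label_realizes[OF True] X(1) by (auto simp: stone_set_members)
    qed (use U(3)[OF U(2)] in \<open>simp add: label_def boxed_top\<close>)
  next
    assume \<psi>: "\<psi> \<in> boxed (label x)"
    show "\<exists>U. openin \<beta>\<omega> U \<and> x \<in> U \<and> (\<forall>y\<in>U. \<psi> \<in> label y)"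
    proof (cases "free_ultrafilter x")
      case True
      \<comment> \<open>The entry contributing \<open>\<psi>\<close> to the level provides the
        neighbourhood.\<close>
      then obtain c where c: "c \<in> path x" "\<psi> \<in> snd c" using \<psi> label_free by (auto simp: level_def)
      have g: "good (path x)" "fst ` path x \<subseteq> members x" using history_good[OF True path_history] by auto
      \<comment> \<open>That neighbourhood also contains principal ultrafilters, which are labelled
        by \<open>top\<close>.\<close>
      have "snd c \<subseteq> top"
      proof -
        have "snd c \<subseteq> level (path x)" using c(1) by (auto simp: level_def)
        then show ?thesis using good_level[OF g(1)] by blast
      qed
      have "\<psi> \<in> label y" if y: "y \<in> stone_set (fst c)" for y
      proof (cases "free_ultrafilter y")
        case yf: True
        have "c \<in> path y" using path_shared[OF True yf c(1)] y by (simp add: stone_set_members)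
        then have "\<psi> \<in> boxed (label y)" using c(2) label_free(2)[OF yf] by (auto simp: level_def)
        then show ?thesis using boxed_subset[OF world_label] by blast
      qed (use c(2) \<open>snd c \<subseteq> top\<close> in \<open>auto simp: label_def\<close>)
      moreover have "x \<in> stone_set (fst c)" using c(1) g(2) Box.prems by (auto simp: stone_set_members)
      ultimately show ?thesis using openin_stone_set by blast
    next
      case False
      then obtain n where "x = principal {n}" using nonfree_ultrafilter_principal Box.prems by blast
      then show ?thesis using \<psi> boxed_subset[OF world_label] openin_stone_set[of "{n}"]
        by (intro exI[of _ "stone_set {n}"]) (auto simp: stone_set_singleton)
    qed
  qed
  finally show ?case by (simp add: boxed_def)
qed simp

lemma root_realized:
  assumes "\<phi> \<notin> w\<^sub>0"
  shows "\<exists>z. free_ultrafilter z \<and> \<phi> \<notin> label z"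
proof -
  have "\<exists>A\<in>fst ` root_history. \<forall>A'\<in>fst ` root_history. A = A' \<or> A \<subset>\<^sup>* A'" by simp
  then obtain y where y: "y \<in> boundary root_history"
    using boundary_nonempty[OF good_root] by blast
  then have "free_ultrafilter y" by (simp add: remainder_def)
  moreover have "UNIV \<in> members y" by (simp add: members_def)
  moreover have "boxed w\<^sub>0 = level root_history" by (simp add: level_def)
  ultimately show ?thesis
    using boundary_realizes[OF _ histories_root y _ root _ assms] by blast
qed

end

lemma completeness_beta:
  assumes "MAD_family \<A>" "completely_separable \<A>" and conseq: "\<Gamma> \<Turnstile>[\<beta>\<omega>] \<phi>"
  shows "\<Gamma> \<turnstile>\<^sub>S\<^sub>4\<^sub>1\<^sub>2 \<phi>"
proof (rule ccontr)
  assume "\<not> \<Gamma> \<turnstile>\<^sub>S\<^sub>4\<^sub>1\<^sub>2 \<phi>"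
  then obtain w where w: "s412_theory.world \<Gamma> w" "\<phi> \<notin> w" by (rule s412_theory.world_refuting)
  interpret beta_model \<A> \<Gamma> w
    using assms w by unfold_locales
  let ?V = "\<lambda>p x. Var p \<in> label x"
  have "valid_in \<beta>\<omega> ?V \<gamma>" if "\<gamma> \<in> \<Gamma>" for \<gamma>
    using truth world_provable[OF world_label derivable.premise[OF that]]
    by (auto simp: valid_in_def topspace_beta)
  then have "valid_in \<beta>\<omega> ?V \<phi>" using conseq by (simp add: consequence_def)
  then have "\<phi> \<in> label z" if "free_ultrafilter z" for z
    using that truth by (auto simp: valid_in_def topspace_beta free_ultrafilter_def)
  then show False using root_realized[OF w(2)] by blast
qed

section \<open>Soundness\<close>

lemma forces_bool_eval: "forces X V x \<phi> \<longleftrightarrow> bool_eval (\<lambda>p. V p x) (\<lambda>\<psi>. forces X V x (\<box> \<psi>)) \<phi>"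
  by (induction \<phi>) auto

lemma forces_S4: "\<phi> \<in> S4_axioms \<Longrightarrow> forces X V x \<phi>"
proof -
  assume "\<phi> \<in> S4_axioms"
  then consider "tautology \<phi>" | \<psi> \<theta> where "\<phi> = \<box> (\<psi> \<^bold>\<longrightarrow> \<theta>) \<^bold>\<longrightarrow> (\<box> \<psi> \<^bold>\<longrightarrow> \<box> \<theta>)"
    | \<psi> where "\<phi> = \<box> \<psi> \<^bold>\<longrightarrow> \<psi>" | \<psi> where "\<phi> = \<box> \<psi> \<^bold>\<longrightarrow> \<box> \<box> \<psi>"
    unfolding S4_axioms_def by blast
  then show ?thesis
  proof cases
    case 1
    then show ?thesis using forces_bool_eval unfolding tautology_def by metis
  next
    case (2 \<psi> \<theta>)
    have "\<exists>U. openin X U \<and> x \<in> U \<and> (\<forall>y\<in>U. forces X V y \<theta>)"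
      if "openin X U" "x \<in> U" "\<forall>y\<in>U. forces X V y \<psi> \<longrightarrow> forces X V y \<theta>"
        "openin X W" "x \<in> W" "\<forall>y\<in>W. forces X V y \<psi>" for U W
      using that by (intro exI[of _ "U \<inter> W"]) (auto intro: openin_Int)
    then show ?thesis unfolding 2 by auto
  qed auto
qed

lemma dense_principal_beta:
  assumes "openin \<beta>\<omega> W" "y \<in> W" "y \<in> stone_set S"
  obtains n where "n \<in> S" "principal {n} \<in> W"
proof -
  have "openin \<beta>\<omega> (W \<inter> stone_set S)" using assms openin_stone_set by blast
  then obtain A where A: "y \<in> stone_set A" "stone_set A \<subseteq> W \<inter> stone_set S"
    using openin_beta assms(2,3) by blast
  then have "A \<noteq> {}" by (auto simp: stone_set_def ultrafilter_def)
  then obtain n where "n \<in> A" by blast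
  then have "principal {n} \<in> stone_set A"
    by (simp add: stone_set_def ultrafilter_principal eventually_principal)
  then have "principal {n} \<in> W" "n \<in> S"
    using A by (auto simp: stone_set_def eventually_principal)
  then show ?thesis using that by blast
qed

text \<open>Both sides hold at \<open>x\<close> iff \<open>x\<close> contains the set
  \<open>S\<close> of numbers whose principal ultrafilters force \<open>\<phi>\<close>: these points
  are isolated, so \<open>\<phi>\<close> agrees there with its box and its diamond, and they are
  dense.\<close>

lemma forces_12_beta:
  assumes "x \<in> topspace \<beta>\<omega>"
  shows "forces \<beta>\<omega> V x (\<box> \<diamond> \<phi>) \<longleftrightarrow> forces \<beta>\<omega> V x (\<diamond> \<box> \<phi>)"
proof -
  have ux: "ultrafilter x" using assms by (simp add: topspace_beta)
  have iso: "openin \<beta>\<omega> {principal {n}}" for n using openin_stone_set[of "{n}"] by (simp add: stone_set_singleton)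
  define S where "S = {n. forces \<beta>\<omega> V (principal {n}) \<phi>}"
  have "forces \<beta>\<omega> V x (\<box> \<diamond> \<phi>) \<longleftrightarrow> S \<in> members x"
  proof
    assume "S \<in> members x"
    then have "x \<in> stone_set S" using ux by (simp add: stone_set_members)
    moreover have "\<exists>z\<in>W. forces \<beta>\<omega> V z \<phi>" if "openin \<beta>\<omega> W" "y \<in> W" "y \<in> stone_set S" for y W
      using dense_principal_beta[OF that] by (auto simp: S_def)
    ultimately show "forces \<beta>\<omega> V x (\<box> \<diamond> \<phi>)" using openin_stone_set[of S] by auto
  next
    assume "forces \<beta>\<omega> V x (\<box> \<diamond> \<phi>)"
    then obtain U where U: "openin \<beta>\<omega> U" "x \<in> U" "\<And>y. y \<in> U \<Longrightarrow> forces \<beta>\<omega> V y (\<diamond> \<phi>)" by auto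
    show "S \<in> members x"
    proof (rule ccontr)
      assume "S \<notin> members x"
      then have "x \<in> stone_set (- S)" using ux by (simp add: stone_set_members members_Compl)
      then obtain n where "n \<in> - S" "principal {n} \<in> U" using dense_principal_beta U(1,2) by blast
      then show False using U(3) iso[of n] by (fastforce simp: S_def)
    qed
  qed
  moreover have "forces \<beta>\<omega> V x (\<diamond> \<box> \<phi>) \<longleftrightarrow> S \<in> members x"
  proof
    assume S: "S \<in> members x"
    have "\<exists>y\<in>W. forces \<beta>\<omega> V y (\<box> \<phi>)" if W: "openin \<beta>\<omega> W" "x \<in> W" for W
    proof -
      have "x \<in> stone_set S" using S ux by (simp add: stone_set_members)
      then obtain n where "n \<in> S" "principal {n} \<in> W" using dense_principal_beta W by blast
      moreover have "forces \<beta>\<omega> V (principal {n}) (\<box> \<phi>)" if "n \<in> S"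
        using iso[of n] that by (auto simp: S_def intro!: exI[of _ "{principal {n}}"])
      ultimately show ?thesis by blast
    qed
    then show "forces \<beta>\<omega> V x (\<diamond> \<box> \<phi>)" unfolding forces.simps by blast
  next
    assume dia: "forces \<beta>\<omega> V x (\<diamond> \<box> \<phi>)"
    show "S \<in> members x"
    proof (rule ccontr)
      assume "S \<notin> members x"
      then have "x \<in> stone_set (- S)" using ux by (simp add: stone_set_members members_Compl)
      then obtain y where y: "y \<in> stone_set (- S)" "forces \<beta>\<omega> V y (\<box> \<phi>)"
        using dia openin_stone_set[of "- S"] unfolding forces.simps by blast
      then obtain W where W: "openin \<beta>\<omega> W" "y \<in> W" "\<And>z. z \<in> W \<Longrightarrow> forces \<beta>\<omega> V z \<phi>" by auto
      then obtain n where "n \<in> - S" "principal {n} \<in> W" using dense_principal_beta y(1) by blast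
      then show False using W(3) by (auto simp: S_def)
    qed
  qed
  ultimately show ?thesis by simp
qed

lemma soundness_beta:
  assumes "\<Gamma> \<turnstile>\<^sub>S\<^sub>4\<^sub>1\<^sub>2 \<phi>"
  shows "\<Gamma> \<Turnstile>[\<beta>\<omega>] \<phi>"
  unfolding consequence_def
proof (intro allI impI)
  fix V assume \<Gamma>: "\<forall>\<gamma>\<in>\<Gamma>. valid_in \<beta>\<omega> V \<gamma>"
  show "valid_in \<beta>\<omega> V \<phi>"
    using assms
  proof induction
    case (axiom \<phi>)
    then consider "\<phi> \<in> S4_axioms" | \<psi> where "\<phi> = \<box> \<diamond> \<psi> \<^bold>\<longleftrightarrow> \<diamond> \<box> \<psi>"
      by (auto simp: S412_axioms_def)
    then show ?case
    proof cases
      case 1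
      then show ?thesis by (simp add: valid_in_def forces_S4)
    next
      case (2 \<psi>)
      have "forces X V x (\<alpha> \<^bold>\<longleftrightarrow> \<beta>) \<longleftrightarrow> (forces X V x \<alpha> \<longleftrightarrow> forces X V x \<beta>)" for X :: "nat filter topology" and x \<alpha> \<beta>
        by auto
      then show ?thesis unfolding 2 valid_in_def using forces_12_beta by blast
    qed
  next
    case (nec \<phi>)
    then show ?case by (auto simp: valid_in_def intro: openin_topspace)
  qed (use \<Gamma> in \<open>auto simp: valid_in_def\<close>)
qed

theorem theorem4p1:
  assumes "\<exists>\<A>. MAD_family \<A> \<and> completely_separable \<A>"
  shows "\<forall>\<Gamma> \<phi>. \<Gamma> \<turnstile>\<^sub>S\<^sub>4\<^sub>1\<^sub>2 \<phi> \<longleftrightarrow> \<Gamma> \<Turnstile>[\<beta>\<omega>] \<phi>"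
  using assms completeness_beta soundness_beta by blast

end
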